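(* Let $K:\mathbb S^{k}\times\mathbb S^{k}\to\mathbb R$ have the form $K(x,y)=g(d(x,y)^2)$ for all $x,y\in\mathbb S^k$, where $g:[0,\infty)\to\mathbb R$ is differentiable with locally Lipschitz continuous derivative. Let $\rho_0,\sigma_0\in\mathcal P(\mathcal D_\varepsilon)$, and let $\rho$ and $\sigma$ be weak solutions, defined on $[0,T)$, to the aggregation model $\partial_t\rho-\nabla_{\mathbb S^k}\cdot(\rho\,\nabla_{\mathbb S^k}K*\rho)=0$ on $\mathcal D_\varepsilon$, starting from $\rho_0$ and $\sigma_0$ respectively. Then there exist $T^*\in(0,T)$ and an increasing, bounded function $r(\varepsilon,\cdot)$ on $[0,T^* )$ with $r(\varepsilon,0)=1$ such that $$W_1(\rho_t,\sigma_t)\le r(\varepsilon,t)\,W_1(\rho_0,\sigma_0)\qquad\text{for all }t\in[0,T^* ).$$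
   Context: $\mathbb S^k\subset\mathbb R^{k+1}$ is the $k$-dimensional unit sphere with the metric induced from $\mathbb R^{k+1}$; its intrinsic distance is $d(x,y)=\arccos(x\cdot y)\in[0,\pi]$. Points and tangent vectors are regarded as vectors of $\mathbb R^{k+1}$. $N=(0,\dots,0,1)$ is the North pole. Fix $\varepsilon\in(0,\pi/2)$ and set $\mathcal D_\varepsilon=\{x\in\mathbb S^k: d(x,N)<\pi/2-\varepsilon\}$. $T\in(0,\infty]$. $\mathcal P(\mathcal D_\varepsilon)$ is the set of Borel probability measures on $\mathcal D_\varepsilon$. $W_1(\rho,\sigma)=\inf_{\pi\in\Pi(\rho,\sigma)}\int d(x,y)\,d\pi(x,y)$ is the intrinsic 1-Wasserstein distance, $\Pi(\rho,\sigma)$ being the set of transport plans (couplings) between $\rho$ and $\sigma$. For a curve $(\rho_t)_{t\in[0,T)}\subset\mathcal P(\mathcal D_\varepsilon)$ the velocity field is $v[\rho](x,t)=-\int_{\mathcal D_\varepsilon}\nabla_{\mathbb S^k}K_y(x)\,d\rho_t(y)$, where $K_y(x)=K(x,y)$ and $\nabla_{\mathbb S^k}$ is the manifold gradient in $x$; for $x,y\in\mathcal D_\varepsilon$, $\nabla_{\mathbb S^k}K_y(x)=-2g'(d(x,y)^2)\log_xy$, with $\log_x y=\frac{\theta}{\sin\theta}(y-\cos\theta\,x)$, $\theta=d(x,y)$ (and $\log_xx=0$). Given a time-dependent vector field $X$ on $\mathcal D_\varepsilon$ and $\Sigma\subset\mathcal D_\varepsilon$, a flow map generated by $(X,\Sigma)$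 on $[0,T)$ is a map $\Psi_X:\Sigma\times[0,T)\to\mathcal D_\varepsilon$, written $\Psi_X^t(x)$, with $\frac{d}{dt}\Psi_X^t(x)=X(\Psi_X^t(x),t)$ and $\Psi_X^0(x)=x$ for all $x\in\Sigma$, $t\in[0,T)$. A curve $(\rho_t)_{t\in[0,T)}\subset\mathcal P(\mathcal D_\varepsilon)$ is a weak solution (starting from $\rho_0$) if $v[\rho]$ generates a unique flow map $\Psi_{v[\rho]}$ defined on $\operatorname{supp}(\rho_0)\times[0,T)$ and $\rho_t=\Psi^t_{v[\rho]}\#\rho_0$ (push-forward) for all $t\in[0,T)$. *)

theory Defs
  imports "HOL-Probability.Probability"
begin

text \<open>
  The ambient space of the \<open>k\<close>-sphere is \<open>(real ^ 'k) \<times> real\<close> with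
  \<open>k = CARD('k)\<close>, that is, the \<open>(k + 1)\<close>-dimensional Euclidean space with its last coordinate
  split off; the sphere itself is \<open>sphere 0 1\<close>.
\<close>

definition north_pole :: "(real ^ 'k) \<times> real" where
  "north_pole = (0, 1)"

definition sphere_dist :: "'a::real_inner \<Rightarrow> 'a \<Rightarrow> real" where
  "sphere_dist x y = arccos (x \<bullet> y)"

definition polar_cap :: "real \<Rightarrow> ((real ^ 'k) \<times> real) set" where
  "polar_cap \<epsilon> = {x \<in> sphere 0 1. sphere_dist x north_pole < pi / 2 - \<epsilon>}"

text \<open>
  The manifold gradient at \<open>x\<close> is the tangent vector \<open>u\<close> that represents the differential of
  \<open>f\<close> along the sphere. Differentiating within the sphere makes this depend only on the
  values of \<open>f\<close> there; the condition \<open>x \<bullet> u = 0\<close> makes \<open>u\<close> tangent and hence unique.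
\<close>

definition sphere_grad :: "('a::euclidean_space \<Rightarrow> real) \<Rightarrow> 'a \<Rightarrow> 'a" where
  "sphere_grad f x =
    (THE u. x \<bullet> u = 0 \<and> (f has_derivative (\<lambda>h. u \<bullet> h)) (at x within sphere 0 1))"

definition locally_lipschitz_on :: "'a::metric_space set \<Rightarrow> ('a \<Rightarrow> 'b::metric_space) \<Rightarrow> bool" where
  "locally_lipschitz_on S f \<longleftrightarrow> (\<forall>x\<in>S. \<exists>\<delta>>0. \<exists>L. L-lipschitz_on (S \<inter> cball x \<delta>) f)"

definition prob_measures_on :: "'a::topological_space set \<Rightarrow> 'a measure set" where
  "prob_measures_on D = {M. prob_space M \<and> sets M = sets (restrict_space borel D)}"

text \<open>For a measure on \<open>D\<close> the support is taken relative to \<open>D = space M\<close>.\<close>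

definition measure_support :: "'a::topological_space measure \<Rightarrow> 'a set" where
  "measure_support M =
    {x \<in> space M. \<forall>U. open U \<and> x \<in> U \<longrightarrow> emeasure M (U \<inter> space M) > 0}"

definition couplings :: "'a measure \<Rightarrow> 'b measure \<Rightarrow> ('a \<times> 'b) measure set" where
  "couplings \<rho> \<sigma> =
    {\<pi>. sets \<pi> = sets (\<rho> \<Otimes>\<^sub>M \<sigma>) \<and> distr \<pi> \<rho> fst = \<rho> \<and> distr \<pi> \<sigma> snd = \<sigma>}"

text \<open>
  The real-valued infimum and integral are harmless: for probability measures on a subset of the
  sphere the set of couplings is nonempty and the cost lies between \<open>0\<close> and \<open>pi\<close>.
\<close>

definition W1 :: "'a::real_inner measure \<Rightarrow> 'a measure \<Rightarrow> real" where
  "W1 \<rho> \<sigma> = (INF \<pi>\<in>couplings \<rho> \<sigma>. \<integral>z. sphere_dist (fst z) (snd z) \<partial>\<pi>)"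

definition velocity ::
  "('a::euclidean_space \<Rightarrow> 'a \<Rightarrow> real) \<Rightarrow> (real \<Rightarrow> 'a measure) \<Rightarrow> 'a \<Rightarrow> real \<Rightarrow> 'a" where
  "velocity K \<rho> x t = - (\<integral>y. sphere_grad (\<lambda>z. K z y) x \<partial>\<rho> t)"

definition time_interval :: "ereal \<Rightarrow> real set" where
  "time_interval T = {t. 0 \<le> t \<and> ereal t < T}"

text \<open>A flow map \<open>\<Psi>\<close> takes the time first; its values outside \<open>\<Sigma>\<close> and \<open>[0, T)\<close> are irrelevant.\<close>

definition is_flow_map ::
  "('a::real_normed_vector \<Rightarrow> real \<Rightarrow> 'a) \<Rightarrow> 'a set \<Rightarrow> 'a set \<Rightarrow> ereal \<Rightarrow> (real \<Rightarrow> 'a \<Rightarrow> 'a) \<Rightarrow> bool" where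
  "is_flow_map X D \<Sigma> T \<Psi> \<longleftrightarrow>
    (\<forall>x\<in>\<Sigma>. \<Psi> 0 x = x \<and>
      (\<forall>t\<in>time_interval T. \<Psi> t x \<in> D \<and>
        ((\<lambda>s. \<Psi> s x) has_vector_derivative X (\<Psi> t x) t) (at t within time_interval T)))"

text \<open>
  The flow is only defined on the support of \<open>\<rho>\<^sub>0\<close>, a set of full measure, so \<open>\<rho>\<^sub>0\<close> is
  restricted to it before being pushed forward.
\<close>

definition weak_solution ::
  "('a::euclidean_space \<Rightarrow> 'a \<Rightarrow> real) \<Rightarrow> 'a set \<Rightarrow> ereal \<Rightarrow> 'a measure \<Rightarrow> (real \<Rightarrow> 'a measure) \<Rightarrow> bool" where
  "weak_solution K D T \<rho>\<^sub>0 \<rho> \<longleftrightarrow>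
    \<rho> 0 = \<rho>\<^sub>0 \<and>
    (\<forall>t\<in>time_interval T. \<rho> t \<in> prob_measures_on D) \<and>
    (\<exists>\<Psi>. is_flow_map (velocity K \<rho>) D (measure_support \<rho>\<^sub>0) T \<Psi> \<and>
      (\<forall>\<Phi>. is_flow_map (velocity K \<rho>) D (measure_support \<rho>\<^sub>0) T \<Phi> \<longrightarrow>
        (\<forall>t\<in>time_interval T. \<forall>x\<in>measure_support \<rho>\<^sub>0. \<Phi> t x = \<Psi> t x)) \<and>
      (\<forall>t\<in>time_interval T.
        \<rho> t = distr (restrict_space \<rho>\<^sub>0 (measure_support \<rho>\<^sub>0)) (restrict_space borel D) (\<Psi> t)))"

end

theory Submission
  imports Defs
begin

text \<open>
  Two weak solutions are compared through a coupling \<open>\<pi>\<close> of their initial measures. Every pair of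
  starting points \<open>(x, y)\<close> is moved by the two flows, and the law of the moved pair couples the
  solutions at time \<open>t\<close>. It therefore suffices to bound the mean distance of the moved pairs by
  \<open>r t\<close> times their mean initial distance, with one function \<open>r\<close> for all \<open>\<pi>\<close>, and to take the infimum
  over \<open>\<pi>\<close>.
  
  The velocity at \<open>x\<close> is the mean over \<open>y\<close> of \<open>- H (x \<bullet> y) *\<^sub>R (y - (x \<bullet> y) *\<^sub>R x)\<close>, where
  \<open>H c = - 2 * g' (\<theta>\<^sup>2) * \<theta> / sin \<theta>\<close> and \<open>\<theta> = arccos c\<close>. Although \<open>arccos\<close> is singular at \<open>1\<close>, its square
  is differentiable there and \<open>\<theta> / sin \<theta>\<close> is Lipschitz in \<open>c\<close> up to \<open>c = 1\<close>. The only true singularity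
  is at antipodal points \<open>c = -1\<close>, and inner products of points of the cap stay away from it
  (\<open>polar_cap_inner_ge\<close>). Hence the interaction kernel is Lipschitz on the cap with respect to the
  ambient norm (\<open>radial_grad_lipschitz\<close>), with a constant \<open>L\<close>.
  
  Let \<open>w\<close> be the difference vector of a moved pair and \<open>E t\<close> the mean of \<open>norm w\<close> at time \<open>t\<close>. The
  Lipschitz bound gives \<open>norm (w' s) \<le> L * (norm (w s) + E s)\<close>. Passing to suprema weighted by
  \<open>exp (- 4 L s)\<close>, first for a single pair and then for the mean, turns this into
  \<open>norm (w t - w 0) \<le> (norm (w 0) + 2 * E 0) / 3 * (exp (4 L t) - 1)\<close> (\<open>coupled_distance_growth\<close>). The mean
  of the right-hand side is \<open>E 0 * (exp (4 L t) - 1)\<close>.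
  
  The last step returns to the intrinsic distance. Bounding it by chords at time \<open>t\<close> and
  chords by it at time \<open>0\<close> would leave a factor larger than \<open>1\<close> at \<open>t = 0\<close>. Only the increment is
  therefore converted: the geodesic distance is a Lipschitz function of the chord length with
  a constant \<open>M\<close> on the cap (\<open>sphere_dist_chord_lipschitz\<close>), so it grows by at most
  \<open>M * norm (w t - w 0)\<close>. This yields \<open>r t = 1 + M * (exp (4 L t) - 1)\<close>.
\<close>

section \<open>The angle as a function of its cosine\<close>

text \<open>
  The function \<open>\<theta> / sin \<theta>\<close> of \<open>c = cos \<theta>\<close>, with its limit value \<open>1\<close> at \<open>c = 1\<close>.
\<close>

definition angle_ratio :: "real \<Rightarrow> real" where
  "angle_ratio c = 1 / sinc (arccos c)"

lemma sinc_pos: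
  assumes "0 \<le> \<theta>" "\<theta> < pi"
  shows "0 < sinc \<theta>"
  using assms sin_gt_zero[of \<theta>] by auto

lemma arccos_less_pi: "-1 < c \<Longrightarrow> c \<le> 1 \<Longrightarrow> arccos c < pi"
  using arccos_le_arccos[of "-1" c] arccos_ubound[of c] cos_arccos[of c] cos_pi
  by (metis linorder_not_le nle_le order_less_imp_le)

text \<open>
  At \<open>c = 1\<close>, where \<open>arccos\<close> has infinite slope, the difference quotient of \<open>\<theta>\<^sup>2\<close> is
  \<open>- \<theta>\<^sup>2 / (1 - cos \<theta>) = - 2 / (sinc (\<theta> / 2))\<^sup>2\<close> by the half-angle formula, and \<open>sinc\<close> is continuous
  at \<open>0\<close>.
\<close>

lemma DERIV_arccos_squared:
  assumes "-1 < c" "c \<le> 1"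
  shows "((\<lambda>c. (arccos c)\<^sup>2) has_real_derivative - 2 * angle_ratio c) (at c within {-1..1})"
proof (cases "c = 1")
  case False
  with assms have c: "-1 < c" "c < 1" by auto
  have "arccos c > 0" using c arccos_lt_bounded by blast
  then have ratio: "angle_ratio c = arccos c / sqrt (1 - c\<^sup>2)"
    using c by (simp add: angle_ratio_def sin_arccos)
  have "((\<lambda>c. (arccos c)\<^sup>2) has_real_derivative - 2 * angle_ratio c) (at c)"
    unfolding ratio by (rule derivative_eq_intros refl c)+ (simp add: field_simps)
  then show ?thesis by (rule has_field_derivative_at_within)
next
  case True
  have pos: "0 < sinc (arccos y / 2)" if "y \<in> {-1..1}" for y
    using that arccos_lbound[of y] arccos_ubound[of y] pi_gt_zero
    by (intro sinc_pos) (auto simp del: pi_gt_zero)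
  have "continuous_on {-1..1} (\<lambda>y. - 2 / (sinc (arccos y / 2))\<^sup>2)"
    by (intro continuous_intros continuous_on_sinc) (use pos in \<open>force\<close>)+
  then have "((\<lambda>y. - 2 / (sinc (arccos y / 2))\<^sup>2) \<longlongrightarrow> - 2 / (sinc (arccos 1 / 2))\<^sup>2)
      (at 1 within {-1..1})"
    by (simp add: continuous_on_def del: arccos_1)
  then have lim: "((\<lambda>y. - 2 / (sinc (arccos y / 2))\<^sup>2) \<longlongrightarrow> - 2) (at 1 within {-1..1})"
    by simp
  have eq: "- 2 / (sinc (arccos y / 2))\<^sup>2 = ((arccos y)\<^sup>2 - (arccos 1)\<^sup>2) / (y - 1)"
    if y: "y \<in> {-1..1}" "y \<noteq> 1" for y
  proof -
    define \<theta> where "\<theta> = arccos y"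
    have \<theta>: "0 < \<theta>" "\<theta> \<le> pi" "y = cos \<theta>"
      using y arccos_lbound[of y] arccos_ubound[of y] cos_arccos[of y] cos_zero
      unfolding \<theta>_def less_le by (metis atLeastAtMost_iff)+
    have "0 < sin (\<theta> / 2)" using \<theta> by (intro sin_gt_zero) auto
    moreover have "y - 1 = - 2 * (sin (\<theta> / 2))\<^sup>2"
      using cos_double_sin[of "\<theta> / 2"] \<theta> by simp
    ultimately show ?thesis
      using \<theta> unfolding \<theta>_def[symmetric] by (simp add: power_divide)
  qed
  have "((\<lambda>y. ((arccos y)\<^sup>2 - (arccos 1)\<^sup>2) / (y - 1)) \<longlongrightarrow> - 2) (at 1 within {-1..1})"
    by (rule Lim_transform_eventually[OF lim])
      (use eq in \<open>auto simp: eventually_at_filter\<close>)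
  then show ?thesis
    using True by (simp add: has_field_derivative_iff angle_ratio_def)
qed

lemma continuous_on_angle_ratio:
  assumes "-1 < c0"
  shows "continuous_on {c0..1} angle_ratio"
proof -
  have "sinc (arccos y) \<noteq> 0" if "y \<in> {c0..1}" for y
    using sinc_pos[of "arccos y"] arccos_less_pi[of y] arccos_lbound[of y] that assms
    by (smt (verit) atLeastAtMost_iff)
  then show ?thesis
    unfolding angle_ratio_def[abs_def] using assms
    by (intro continuous_intros continuous_on_sinc) auto
qed

lemma angle_ratio_bounded:
  assumes "-1 < c0"
  obtains B where "0 \<le> B" "\<And>c. c \<in> {c0..1} \<Longrightarrow> \<bar>angle_ratio c\<bar> \<le> B"
proof -
  have "bounded (angle_ratio ` {c0..1})"
    by (intro compact_imp_bounded compact_continuous_image continuous_on_angle_ratio assms compact_Icc)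
  then obtain B where B: "\<forall>c\<in>{c0..1}. \<bar>angle_ratio c\<bar> \<le> B"
    by (auto simp: bounded_iff)
  show ?thesis by (rule that[of "\<bar>B\<bar>"]) (use B in force)+
qed

lemma abs_sin_minus_x_cos_le:
  fixes \<theta> :: real
  assumes "0 \<le> \<theta>"
  shows "\<bar>sin \<theta> - \<theta> * cos \<theta>\<bar> \<le> \<theta> ^ 3"
proof (cases "\<theta> = 0")
  case False
  with assms have "0 < \<theta>" by simp
  moreover have "((\<lambda>x. sin x - x * cos x) has_real_derivative x * sin x) (at x)" for x :: real
    by (auto intro!: derivative_eq_intros)
  ultimately obtain z where z: "0 < z" "z < \<theta>"
    "(sin \<theta> - \<theta> * cos \<theta>) - (sin 0 - 0 * cos 0) = (\<theta> - 0) * (z * sin z)"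
    using MVT2[of 0 \<theta> "\<lambda>x. sin x - x * cos x" "\<lambda>x. x * sin x"] by auto
  have "\<bar>z * sin z\<bar> \<le> \<theta> * \<theta>"
    using z abs_sin_x_le_abs_x[of z] by (auto simp: abs_mult intro!: mult_mono)
  then have "\<theta> * \<bar>z * sin z\<bar> \<le> \<theta> * (\<theta> * \<theta>)" using assms by (intro mult_left_mono) auto
  then show ?thesis using z assms by (simp add: abs_mult power3_eq_cube)
qed simp

text \<open>
  The derivative is required only inside the interval, since \<open>\<theta>\<^sup>2\<close> and \<open>\<theta> / sin \<theta>\<close> are
  differentiated through \<open>arccos\<close>, which has no finite derivative at \<open>1\<close>.
\<close>

lemma lipschitz_on_real_derivativeI:
  fixes f :: "real \<Rightarrow> real"
  assumes "continuous_on {a..b} f" "0 \<le> B"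
    and "\<And>x. a < x \<Longrightarrow> x < b \<Longrightarrow> \<exists>D. (f has_real_derivative D) (at x) \<and> \<bar>D\<bar> \<le> B"
  shows "B-lipschitz_on {a..b} f"
proof (rule lipschitz_on_leI)
  fix x y assume xy: "x \<in> {a..b}" "y \<in> {a..b}" "x \<le> y"
  show "dist (f x) (f y) \<le> B * dist x y"
  proof (cases "x = y")
    case False
    with xy have "x < y" by simp
    moreover have "continuous_on {x..y} f"
      using assms(1) xy by (auto intro: continuous_on_subset)
    moreover have "f differentiable (at z)" if "x < z" "z < y" for z
      using assms(3)[of z] that xy by (auto simp: real_differentiable_def)
    ultimately obtain l z where z: "x < z" "z < y" "(f has_real_derivative l) (at z)"
      "f y - f x = (y - x) * l"
      using MVT[of x y f] by metis
    then obtain D where D: "(f has_real_derivative D) (at z)" "\<bar>D\<bar> \<le> B"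
      using assms(3)[of z] xy by auto
    then have "l = D" using z DERIV_unique by blast
    then have "\<bar>f y - f x\<bar> \<le> (y - x) * B"
      using z D \<open>x < y\<close> by (simp add: abs_mult mult_left_mono)
    then show ?thesis using \<open>x < y\<close> by (simp add: dist_real_def abs_minus_commute mult.commute)
  qed simp
qed (rule assms)

text \<open>
  For \<open>c < 1\<close> the derivative of \<open>\<theta> / sin \<theta>\<close> with respect to \<open>c = cos \<theta>\<close> is
  \<open>- (sin \<theta> - \<theta> * cos \<theta>) / sin \<theta> ^ 3\<close>. The numerator is at most \<open>\<theta> ^ 3\<close> in modulus, so the cube of
  a bound for \<open>\<theta> / sin \<theta>\<close> bounds the derivative up to \<open>c = 1\<close>.
\<close>

lemma angle_ratio_lipschitz:
  assumes "-1 < c0"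
  obtains L where "L-lipschitz_on {c0..1} angle_ratio"
proof (cases "c0 \<le> 1")
  case False
  then have "0-lipschitz_on {c0..1} angle_ratio" by simp
  then show ?thesis by (rule that)
next
  case True
  obtain B where "0 \<le> B" and B: "\<And>c. c \<in> {c0..1} \<Longrightarrow> \<bar>angle_ratio c\<bar> \<le> B"
    using angle_ratio_bounded[OF assms] by blast
  have "\<exists>D. (angle_ratio has_real_derivative D) (at c) \<and> \<bar>D\<bar> \<le> B ^ 3"
    if c: "c0 < c" "c < 1" for c
  proof -
    have c1: "-1 < c" using c assms by simp
    define \<theta> where "\<theta> = arccos c"
    have \<theta>: "0 < \<theta>" "\<theta> < pi" using c c1 arccos_lt_bounded by (auto simp: \<theta>_def)
    then have s: "0 < sin \<theta>" by (rule sin_gt_zero)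
    have sq: "sqrt (1 - c\<^sup>2) = sin \<theta>" "c = cos \<theta>"
      using c c1 by (auto simp: \<theta>_def sin_arccos)
    have "\<bar>\<theta> / sin \<theta>\<bar> \<le> B" using B[of c] c \<theta> by (simp add: angle_ratio_def \<theta>_def)
    then have ratio: "(\<theta> / sin \<theta>) ^ 3 \<le> B ^ 3" using s \<theta> by (intro power_mono) auto
    have pos1: "0 < 1 - c\<^sup>2" using s sq by (metis real_sqrt_gt_0_iff)
    have "((\<lambda>c. arccos c / sqrt (1 - c\<^sup>2)) has_real_derivative
        - (sin \<theta> - \<theta> * cos \<theta>) / sin \<theta> ^ 3) (at c)"
    proof -
      have "((\<lambda>c. arccos c / sqrt (1 - c\<^sup>2)) has_real_derivative
        (inverse (- sqrt (1 - c\<^sup>2)) * sqrt (1 - c\<^sup>2)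
           - arccos c * (inverse (sqrt (1 - c\<^sup>2)) / 2 * (- 2 * c))) / (sqrt (1 - c\<^sup>2) * sqrt (1 - c\<^sup>2))) (at c)"
        using pos1 c c1 by (auto intro!: derivative_eq_intros)
      then show ?thesis
        unfolding sq(1) using s sq(2) unfolding \<theta>_def[symmetric]
        by (simp add: field_simps power3_eq_cube)
    qed
    moreover have "eventually (\<lambda>c. angle_ratio c = arccos c / sqrt (1 - c\<^sup>2)) (nhds c)"
    proof -
      have "eventually (\<lambda>c. c \<in> {-1<..<1}) (nhds c)"
        using c c1 by (intro eventually_nhds_in_open) auto
      then show ?thesis
      proof eventually_elim
        case (elim c)
        then have "0 < arccos c" using arccos_lt_bounded by auto
        with elim show ?case by (simp add: angle_ratio_def sin_arccos)
      qed
    qed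
    ultimately have "(angle_ratio has_real_derivative - (sin \<theta> - \<theta> * cos \<theta>) / sin \<theta> ^ 3) (at c)"
      by (subst DERIV_cong_ev[OF refl _ refl]) auto
    moreover have "\<bar>- (sin \<theta> - \<theta> * cos \<theta>) / sin \<theta> ^ 3\<bar> \<le> B ^ 3"
    proof -
      have "\<bar>- (sin \<theta> - \<theta> * cos \<theta>) / sin \<theta> ^ 3\<bar> = \<bar>sin \<theta> - \<theta> * cos \<theta>\<bar> / sin \<theta> ^ 3"
        using s by (simp add: abs_divide)
      also have "\<dots> \<le> \<theta> ^ 3 / sin \<theta> ^ 3"
        using abs_sin_minus_x_cos_le[of \<theta>] \<theta> s by (intro divide_right_mono) auto
      also have "\<dots> \<le> B ^ 3" using ratio by (simp add: power_divide)
      finally show ?thesis .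
    qed
    ultimately show ?thesis by blast
  qed
  then have "(B ^ 3)-lipschitz_on {c0..1} angle_ratio"
    using continuous_on_angle_ratio[OF assms] \<open>0 \<le> B\<close> by (intro lipschitz_on_real_derivativeI) auto
  then show ?thesis by (rule that)
qed

lemma arccos_squared_lipschitz:
  assumes "-1 < c0"
  obtains L where "L-lipschitz_on {c0..1} (\<lambda>c. (arccos c)\<^sup>2)"
proof -
  obtain B where "0 \<le> B" and B: "\<And>c. c \<in> {c0..1} \<Longrightarrow> \<bar>angle_ratio c\<bar> \<le> B"
    using angle_ratio_bounded[OF assms] by blast
  have "(2 * B)-lipschitz_on {c0..1} (\<lambda>c. (arccos c)\<^sup>2)"
  proof (rule lipschitz_on_real_derivativeI)
    fix c assume c: "c0 < c" "c < 1"
    then have "((\<lambda>c. (arccos c)\<^sup>2) has_real_derivative - 2 * angle_ratio c) (at c within {-1..1})"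
      using assms by (intro DERIV_arccos_squared) auto
    moreover have "at c within {-1..1} = at c"
      using c assms by (intro at_within_interior) auto
    ultimately show "\<exists>D. ((\<lambda>c. (arccos c)\<^sup>2) has_real_derivative D) (at c) \<and> \<bar>D\<bar> \<le> 2 * B"
      using B[of c] c by (intro exI[of _ "- 2 * angle_ratio c"]) (auto simp: abs_mult)
  qed (use assms \<open>0 \<le> B\<close> in \<open>auto intro!: continuous_intros\<close>)
  then show ?thesis by (rule that)
qed

lemma locally_lipschitz_on_compact:
  fixes f :: "'a::metric_space \<Rightarrow> 'b::metric_space"
  assumes "locally_lipschitz_on S f" "compact X" "X \<subseteq> S"
  obtains L where "L-lipschitz_on X f"
proof -
  have "local_lipschitz {0::real} X (\<lambda>_. f)"
    unfolding local_lipschitz_def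
  proof (intro ballI)
    fix x assume "x \<in> X"
    then obtain \<delta> L where "\<delta> > 0" "L-lipschitz_on (S \<inter> cball x \<delta>) f"
      using assms unfolding locally_lipschitz_on_def by blast
    moreover from this(2) have "L-lipschitz_on (cball x \<delta> \<inter> X) f"
      by (rule lipschitz_on_subset) (use assms in auto)
    ultimately show "\<exists>u>0. \<exists>L. \<forall>t\<in>cball t u \<inter> {0::real}. L-lipschitz_on (cball x u \<inter> X) f" for t
      by blast
  qed
  then obtain L where "\<And>t. t \<in> {0::real} \<Longrightarrow> L-lipschitz_on X f"
    by (rule local_lipschitz_compact_implies_lipschitz) (use assms in auto)
  then show ?thesis using that by blast
qed

lemma lipschitz_on_mult_bounded:
  fixes f h :: "'a::metric_space \<Rightarrow> real"
  assumes f: "L-lipschitz_on S f" and h: "M-lipschitz_on S h"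
    and fB: "\<And>x. x \<in> S \<Longrightarrow> \<bar>f x\<bar> \<le> B" and hC: "\<And>x. x \<in> S \<Longrightarrow> \<bar>h x\<bar> \<le> C"
    and "0 \<le> B" "0 \<le> C"
  shows "(L * C + B * M)-lipschitz_on S (\<lambda>x. f x * h x)"
proof (rule lipschitz_onI)
  have nn: "0 \<le> L" "0 \<le> M" using f h lipschitz_on_nonneg by auto
  then show "0 \<le> L * C + B * M" using assms by simp
  fix x y assume xy: "x \<in> S" "y \<in> S"
  have "\<bar>f x * h x - f y * h y\<bar> = \<bar>(f x - f y) * h x + f y * (h x - h y)\<bar>"
    by (simp add: algebra_simps)
  also have "\<dots> \<le> \<bar>f x - f y\<bar> * \<bar>h x\<bar> + \<bar>f y\<bar> * \<bar>h x - h y\<bar>"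
    by (metis abs_mult abs_triangle_ineq)
  also have "\<dots> \<le> (L * dist x y) * C + B * (M * dist x y)"
    using lipschitz_onD[OF f xy] lipschitz_onD[OF h xy] fB hC xy nn assms
    by (intro add_mono mult_mono) (auto simp: dist_real_def)
  finally show "dist (f x * h x) (f y * h y) \<le> (L * C + B * M) * dist x y"
    by (simp add: dist_real_def algebra_simps)
qed

section \<open>The gradient of a radial potential on the sphere\<close>

text \<open>
  If \<open>u - v\<close> were nonzero, the great circle through \<open>x\<close> in that direction would stay in the sphere,
  and the derivative of \<open>f\<close> along it would be both \<open>u \<bullet> e\<close> and \<open>v \<bullet> e\<close>.
\<close>

lemma sphere_derivative_unique:
  fixes f :: "'a::euclidean_space \<Rightarrow> real"
  assumes x: "x \<in> sphere 0 1"
    and u: "x \<bullet> u = 0" "(f has_derivative (\<lambda>h. u \<bullet> h)) (at x within sphere 0 1)"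
    and v: "x \<bullet> v = 0" "(f has_derivative (\<lambda>h. v \<bullet> h)) (at x within sphere 0 1)"
  shows "u = v"
proof (rule ccontr)
  assume "u \<noteq> v"
  define e where "e = (u - v) /\<^sub>R norm (u - v)"
  have e: "norm e = 1" "x \<bullet> e = 0" using \<open>u \<noteq> v\<close> u v by (auto simp: e_def inner_diff_right)
  define \<gamma> where "\<gamma> t = cos t *\<^sub>R x + sin t *\<^sub>R e" for t
  have "\<gamma> t \<bullet> \<gamma> t = 1" for t
  proof -
    have "x \<bullet> x = 1" "e \<bullet> e = 1" using x e by (auto simp: dot_square_norm)
    then show ?thesis
      using e by (simp add: \<gamma>_def inner_add_left inner_add_right inner_commute[of e x]
          flip: power2_eq_square)
  qed
  then have img: "\<gamma> ` UNIV \<subseteq> sphere 0 1" by (auto simp: norm_eq_1)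
  have deriv: "(\<gamma> has_derivative (\<lambda>t. t *\<^sub>R e)) (at 0)"
    unfolding \<gamma>_def by (auto intro!: derivative_eq_intros)
  have "((\<lambda>t. f (\<gamma> t)) has_derivative (\<lambda>t. w \<bullet> (t *\<^sub>R e))) (at 0)"
    if "(f has_derivative (\<lambda>h. w \<bullet> h)) (at x within sphere 0 1)" for w
  proof (rule has_derivative_in_compose[OF deriv])
    show "(f has_derivative (\<bullet>) w) (at (\<gamma> 0) within range \<gamma>)"
      using has_derivative_subset[OF that img] by (simp add: \<gamma>_def)
  qed
  from has_derivative_unique[OF this[OF u(2)] this[OF v(2)]]
  have "u \<bullet> e = v \<bullet> e" by (metis scaleR_one)
  then have "(u - v) \<bullet> e = 0" by (simp add: inner_diff_left)
  then show False using \<open>u \<noteq> v\<close> by (simp add: e_def)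
qed

lemma sphere_grad_eqI:
  fixes f :: "'a::euclidean_space \<Rightarrow> real"
  assumes "x \<in> sphere 0 1" "x \<bullet> u = 0" "(f has_derivative (\<lambda>h. u \<bullet> h)) (at x within sphere 0 1)"
  shows "sphere_grad f x = u"
  unfolding sphere_grad_def using assms sphere_derivative_unique[of x]
  by (intro the_equality) auto

text \<open>
  On the sphere \<open>f\<close> agrees with \<open>f y - (u \<bullet> x) / 2 * (y \<bullet> y - 1)\<close>, whose gradient at \<open>x\<close> has no
  component along \<open>x\<close>.
\<close>

lemma has_derivative_sphere_tangential:
  fixes f :: "'a::euclidean_space \<Rightarrow> real"
  assumes x: "x \<in> sphere 0 1"
    and f: "(f has_derivative (\<lambda>h. u \<bullet> h)) (at x within sphere 0 1)"
  shows "(f has_derivative (\<lambda>h. (u - (u \<bullet> x) *\<^sub>R x) \<bullet> h)) (at x within sphere 0 1)"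
proof (rule has_derivative_transform_within[OF _ zero_less_one x])
  show "((\<lambda>y. f y - (u \<bullet> x) / 2 * (y \<bullet> y - 1)) has_derivative
      (\<lambda>h. (u - (u \<bullet> x) *\<^sub>R x) \<bullet> h)) (at x within sphere 0 1)"
    by (rule derivative_eq_intros f refl)+
      (simp add: fun_eq_iff inner_diff_left inner_diff_right inner_commute)
  show "f y - (u \<bullet> x) / 2 * (y \<bullet> y - 1) = f y" if "y \<in> sphere 0 1" for y
    using that by (simp add: dot_square_norm)
qed

text \<open>
  The derivative of \<open>g ((arccos c)\<^sup>2)\<close> with respect to \<open>c\<close>, when \<open>g'\<close> is the derivative of \<open>g\<close>.
\<close>

definition radial_slope :: "(real \<Rightarrow> real) \<Rightarrow> real \<Rightarrow> real" where
  "radial_slope g' c = - 2 * (g' ((arccos c)\<^sup>2) * angle_ratio c)"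

text \<open>
  Equal to \<open>- 2 * g' (\<theta>\<^sup>2)\<close> times the Riemannian logarithm of \<open>y\<close> at \<open>x\<close>, where \<open>\<theta>\<close> is the angle
  between \<open>x\<close> and \<open>y\<close>. In this form the kernel depends on \<open>x\<close> and \<open>y\<close> only through vector algebra and a
  function of \<open>x \<bullet> y\<close>.
\<close>

definition radial_grad :: "(real \<Rightarrow> real) \<Rightarrow> 'a::real_inner \<Rightarrow> 'a \<Rightarrow> 'a" where
  "radial_grad g' x y = radial_slope g' (x \<bullet> y) *\<^sub>R (y - (x \<bullet> y) *\<^sub>R x)"

lemma inner_sphere_bounds:
  assumes "x \<in> sphere 0 1" "y \<in> sphere 0 1"
  shows "x \<bullet> y \<in> {-1..1}"
  using Cauchy_Schwarz_ineq2[of x y] assms by auto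

text \<open>
  The potential is \<open>g\<close> of the squared angle of the linear function \<open>z \<bullet> y\<close>. The chain rule is
  applied within the images \<open>{-1..1}\<close> and \<open>{0..}\<close>, which covers the end points, in
  particular the case \<open>x = y\<close>.
\<close>

lemma sphere_grad_radial:
  fixes K :: "'a::euclidean_space \<Rightarrow> 'a \<Rightarrow> real"
  assumes K: "\<And>x y. x \<in> sphere 0 1 \<Longrightarrow> y \<in> sphere 0 1 \<Longrightarrow> K x y = g ((sphere_dist x y)\<^sup>2)"
    and g: "\<And>s. 0 \<le> s \<Longrightarrow> (g has_real_derivative g' s) (at s within {0..})"
    and x: "x \<in> sphere 0 1" and y: "y \<in> sphere 0 1" and "-1 < x \<bullet> y"
  shows "sphere_grad (\<lambda>z. K z y) x = radial_grad g' x y"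
proof -
  let ?c = "x \<bullet> y"
  have c: "-1 < ?c" "?c \<le> 1" using inner_sphere_bounds[OF x y] assms by auto
  have "((\<lambda>c. (arccos c)\<^sup>2) has_derivative (*) (- 2 * angle_ratio ?c)) (at ?c within {-1..1})"
    using DERIV_arccos_squared[OF c] by (simp add: has_field_derivative_def)
  then have on_image: "((\<lambda>c. (arccos c)\<^sup>2) has_derivative (*) (- 2 * angle_ratio ?c))
      (at ?c within (\<lambda>z. z \<bullet> y) ` sphere 0 1)"
    by (rule has_derivative_subset) (use inner_sphere_bounds[OF _ y] in blast)
  have "((\<lambda>z. z \<bullet> y) has_derivative (\<lambda>h. h \<bullet> y)) (at x within sphere 0 1)"
    by (auto intro!: derivative_eq_intros)
  from has_derivative_in_compose[OF this on_image]
  have sq: "((\<lambda>z. (arccos (z \<bullet> y))\<^sup>2) has_derivative (\<lambda>h. - 2 * angle_ratio ?c * (h \<bullet> y)))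
      (at x within sphere 0 1)" .
  have "(g has_derivative (*) (g' ((arccos ?c)\<^sup>2))) (at ((arccos ?c)\<^sup>2) within {0..})"
    using g[of "(arccos ?c)\<^sup>2"] by (simp add: has_field_derivative_def)
  then have "(g has_derivative (*) (g' ((arccos ?c)\<^sup>2)))
      (at ((arccos ?c)\<^sup>2) within (\<lambda>z. (arccos (z \<bullet> y))\<^sup>2) ` sphere 0 1)"
    by (rule has_derivative_subset) auto
  from has_derivative_in_compose[OF sq this]
  have "((\<lambda>z. g ((arccos (z \<bullet> y))\<^sup>2)) has_derivative (\<lambda>h. (radial_slope g' ?c *\<^sub>R y) \<bullet> h))
      (at x within sphere 0 1)"
    by (simp add: radial_slope_def inner_commute mult_ac)
  then have "((\<lambda>z. K z y) has_derivative (\<lambda>h. (radial_slope g' ?c *\<^sub>R y) \<bullet> h))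
      (at x within sphere 0 1)"
    by (rule has_derivative_transform_within[OF _ zero_less_one x])
      (use K y in \<open>auto simp: sphere_dist_def\<close>)
  from has_derivative_sphere_tangential[OF x this]
  have "((\<lambda>z. K z y) has_derivative (\<lambda>h. radial_grad g' x y \<bullet> h)) (at x within sphere 0 1)"
    by (simp add: radial_grad_def scaleR_diff_right inner_commute)
  moreover have "x \<bullet> radial_grad g' x y = 0"
    using x by (simp add: radial_grad_def inner_diff_right dot_square_norm)
  ultimately show ?thesis using x by (intro sphere_grad_eqI)
qed

text \<open>
  The squared angle maps \<open>{c0..1}\<close> onto a compact set, where \<open>g'\<close> is Lipschitz with a single
  constant. The slope is then a product of bounded Lipschitz functions.
\<close>

lemma radial_slope_lipschitz:
  assumes "-1 < c0" "locally_lipschitz_on {0..} g'"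
  obtains L where "L-lipschitz_on {c0..1} (radial_slope g')"
proof -
  obtain A where A: "A-lipschitz_on {c0..1} (\<lambda>c. (arccos c)\<^sup>2)"
    using arccos_squared_lipschitz assms by blast
  let ?X = "(\<lambda>c. (arccos c)\<^sup>2) ` {c0..1}"
  have "compact ?X"
    using assms by (intro compact_continuous_image continuous_intros) auto
  then obtain L where L: "L-lipschitz_on ?X g'"
    using locally_lipschitz_on_compact[OF assms(2)] by (metis atLeast_iff image_subsetI zero_le_power2)
  have gl: "(L * A)-lipschitz_on {c0..1} (\<lambda>c. g' ((arccos c)\<^sup>2))"
    using lipschitz_on_compose2[OF A L] .
  have "bounded ((\<lambda>c. g' ((arccos c)\<^sup>2)) ` {c0..1})"
    by (intro compact_imp_bounded compact_continuous_image lipschitz_on_continuous_on[OF gl] compact_Icc)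
  then obtain C where C: "\<forall>c\<in>{c0..1}. \<bar>g' ((arccos c)\<^sup>2)\<bar> \<le> C"
    by (auto simp: bounded_iff)
  obtain M where M: "M-lipschitz_on {c0..1} angle_ratio"
    using angle_ratio_lipschitz assms by blast
  obtain B where B: "0 \<le> B" "\<And>c. c \<in> {c0..1} \<Longrightarrow> \<bar>angle_ratio c\<bar> \<le> B"
    using angle_ratio_bounded assms by blast
  have "(L * A * B + \<bar>C\<bar> * M)-lipschitz_on {c0..1} (\<lambda>c. g' ((arccos c)\<^sup>2) * angle_ratio c)"
    by (rule lipschitz_on_mult_bounded[OF gl M _ B(2)]) (use C B in force)+
  from lipschitz_on_cmult_real[OF this, of "-2"] that show ?thesis
    unfolding radial_slope_def[abs_def] by blast
qed

lemma radial_grad_lipschitz: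
  fixes D :: "'a::euclidean_space set"
  assumes c0: "-1 < c0" and D: "D \<subseteq> sphere 0 1" "\<And>x y. x \<in> D \<Longrightarrow> y \<in> D \<Longrightarrow> c0 \<le> x \<bullet> y"
    and g': "locally_lipschitz_on {0..} g'"
  obtains L where "0 < L"
    "\<And>x y x' y'. \<lbrakk>x \<in> D; y \<in> D; x' \<in> D; y' \<in> D\<rbrakk> \<Longrightarrow>
      norm (radial_grad g' x y - radial_grad g' x' y') \<le> L * (norm (x - x') + norm (y - y'))"
proof -
  obtain S where S: "S-lipschitz_on {c0..1} (radial_slope g')"
    using radial_slope_lipschitz c0 g' by blast
  have "bounded (radial_slope g' ` {c0..1})"
    by (intro compact_imp_bounded compact_continuous_image lipschitz_on_continuous_on[OF S] compact_Icc)
  then obtain B where B: "\<forall>c\<in>{c0..1}. \<bar>radial_slope g' c\<bar> \<le> B"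
    by (auto simp: bounded_iff)
  have bound: "norm (radial_grad g' x y - radial_grad g' x' y')
      \<le> (2 * S + 2 * \<bar>B\<bar> + 1) * (norm (x - x') + norm (y - y'))"
    if "x \<in> D" "y \<in> D" "x' \<in> D" "y' \<in> D" for x y x' y'
  proof -
    define c c' s where "c = x \<bullet> y" and "c' = x' \<bullet> y'" and "s = norm (x - x') + norm (y - y')"
    have n: "norm x = 1" "norm y = 1" "norm x' = 1" "norm y' = 1" using that D by auto
    have cI: "c \<in> {c0..1}" "c' \<in> {c0..1}"
      using that D(2) inner_sphere_bounds[of x y] inner_sphere_bounds[of x' y'] n
      by (simp_all add: c_def c'_def)
    have c1: "\<bar>c\<bar> \<le> 1" "\<bar>c'\<bar> \<le> 1" using cI c0 by auto
    have "c - c' = (x - x') \<bullet> y + x' \<bullet> (y - y')"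
      by (simp add: c_def c'_def inner_diff_left inner_diff_right)
    then have cc: "\<bar>c - c'\<bar> \<le> s"
      using Cauchy_Schwarz_ineq2[of "x - x'" y] Cauchy_Schwarz_ineq2[of x' "y - y'"] n
      by (simp add: s_def)
    have S0: "0 \<le> S" using S lipschitz_on_nonneg by blast
    have slope: "\<bar>radial_slope g' c - radial_slope g' c'\<bar> \<le> S * s"
      using lipschitz_onD[OF S cI] mult_left_mono[OF cc S0] by (simp add: dist_real_def)
    have v: "norm (y - c *\<^sub>R x) \<le> 2"
      using norm_triangle_ineq4[of y "c *\<^sub>R x"] n c1 by simp
    have "(y - c *\<^sub>R x) - (y' - c' *\<^sub>R x') = (y - y') - (c *\<^sub>R (x - x') + (c - c') *\<^sub>R x')"
      by (simp add: algebra_simps)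
    then have "norm ((y - c *\<^sub>R x) - (y' - c' *\<^sub>R x'))
        \<le> norm (y - y') + norm (c *\<^sub>R (x - x') + (c - c') *\<^sub>R x')"
      using norm_triangle_ineq4 by metis
    also have "\<dots> \<le> norm (y - y') + (norm (c *\<^sub>R (x - x')) + norm ((c - c') *\<^sub>R x'))"
      by (intro add_left_mono norm_triangle_ineq)
    also have "\<dots> \<le> norm (y - y') + (norm (x - x') + s)"
      using c1(1) cc n(3) by (simp add: add_mono mult_left_le_one_le)
    finally have vv: "norm ((y - c *\<^sub>R x) - (y' - c' *\<^sub>R x')) \<le> 2 * s"
      by (simp add: s_def)
    have "radial_grad g' x y - radial_grad g' x' y'
        = (radial_slope g' c - radial_slope g' c') *\<^sub>R (y - c *\<^sub>R x)
          + radial_slope g' c' *\<^sub>R ((y - c *\<^sub>R x) - (y' - c' *\<^sub>R x'))"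
      by (simp add: radial_grad_def c_def c'_def algebra_simps)
    also have "norm \<dots> \<le> \<bar>radial_slope g' c - radial_slope g' c'\<bar> * norm (y - c *\<^sub>R x)
        + \<bar>radial_slope g' c'\<bar> * norm ((y - c *\<^sub>R x) - (y' - c' *\<^sub>R x'))"
      by (metis norm_scaleR norm_triangle_ineq)
    also have "\<dots> \<le> (S * s) * 2 + \<bar>B\<bar> * (2 * s)"
      using slope v vv B[rule_format, OF cI(2)] S0 by (intro add_mono mult_mono) (auto simp: s_def)
    also have "\<dots> \<le> (2 * S + 2 * \<bar>B\<bar> + 1) * s"
      by (simp add: s_def algebra_simps)
    finally show ?thesis by (simp add: s_def)
  qed
  show ?thesis
    by (rule that[of "2 * S + 2 * \<bar>B\<bar> + 1"]) (use bound lipschitz_on_nonneg[OF S] in auto)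
qed

section \<open>Chords, arcs and polar caps\<close>

lemma sphere_dist_nonneg:
  assumes "x \<in> sphere 0 1" "y \<in> sphere 0 1"
  shows "0 \<le> sphere_dist x y"
  using inner_sphere_bounds[OF assms] by (auto simp: sphere_dist_def intro: arccos_lbound)

lemma chord_eq_sin_half_angle:
  assumes "x \<in> sphere 0 1" "y \<in> sphere 0 1"
  shows "norm (x - y) = 2 * sin (sphere_dist x y / 2)"
proof -
  have b: "x \<bullet> y \<in> {-1..1}" using assms by (rule inner_sphere_bounds)
  then have \<theta>: "0 \<le> sphere_dist x y" "sphere_dist x y \<le> pi" "cos (sphere_dist x y) = x \<bullet> y"
    unfolding sphere_dist_def by (auto intro: arccos_lbound arccos_ubound)
  have "(norm (x - y))\<^sup>2 = 2 - 2 * (x \<bullet> y)"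
    using assms dot_norm_neg[of x y] by (simp add: field_simps)
  also have "\<dots> = (2 * sin (sphere_dist x y / 2))\<^sup>2"
    using cos_double_sin[of "sphere_dist x y / 2"] \<theta> by (simp add: power_mult_distrib)
  finally show ?thesis
    using \<theta> by (intro power2_eq_imp_eq[of "norm (x - y)"]) (auto intro!: sin_ge_zero)
qed

text \<open>
  The chord \<open>2 * sin (\<theta> / 2)\<close> is an increasing function of the angle \<open>\<theta>\<close> with slope
  \<open>cos (\<theta> / 2)\<close>, bounded below as long as \<open>\<theta>\<close> stays below some \<open>\<Theta> < pi\<close>. Its inverse is therefore
  Lipschitz.
\<close>

lemma sphere_dist_chord_lipschitz:
  fixes D :: "'a::euclidean_space set"
  assumes c0: "-1 < c0" and D: "D \<subseteq> sphere 0 1" "\<And>x y. x \<in> D \<Longrightarrow> y \<in> D \<Longrightarrow> c0 \<le> x \<bullet> y"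
  obtains M where "0 < M"
    "\<And>x y x' y'. \<lbrakk>x \<in> D; y \<in> D; x' \<in> D; y' \<in> D\<rbrakk> \<Longrightarrow>
      \<bar>sphere_dist x y - sphere_dist x' y'\<bar> \<le> M * \<bar>norm (x - y) - norm (x' - y')\<bar>"
proof -
  define \<Theta> where "\<Theta> = arccos (min c0 1)"
  have \<Theta>: "0 \<le> \<Theta>" "\<Theta> < pi"
    using c0 arccos_less_pi[of "min c0 1"] arccos_lbound[of "min c0 1"] by (auto simp: \<Theta>_def)
  have k: "0 < cos (\<Theta> / 2)" using \<Theta> by (intro cos_gt_zero_pi) auto
  have range: "0 \<le> sphere_dist x y" "sphere_dist x y \<le> \<Theta>" if "x \<in> D" "y \<in> D" for x y
  proof -
    have "x \<bullet> y \<in> {-1..1}" using that D(1) by (intro inner_sphere_bounds) auto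
    then show "0 \<le> sphere_dist x y" "sphere_dist x y \<le> \<Theta>"
      using D(2)[OF that] c0
      by (auto simp: sphere_dist_def \<Theta>_def intro!: arccos_lbound arccos_le_arccos)
  qed
  have mono: "cos (\<Theta> / 2) * (b - a) \<le> 2 * sin (b / 2) - 2 * sin (a / 2)"
    if "0 \<le> a" "a \<le> b" "b \<le> \<Theta>" for a b :: real
  proof (cases "a = b")
    case False
    with that have "a < b" by simp
    moreover have "((\<lambda>x. 2 * sin (x / 2)) has_real_derivative cos (x / 2)) (at x)" for x :: real
      by (auto intro!: derivative_eq_intros)
    ultimately obtain z where z: "a < z" "z < b"
      "2 * sin (b / 2) - 2 * sin (a / 2) = (b - a) * cos (z / 2)"
      using MVT2[of a b "\<lambda>x. 2 * sin (x / 2)" "\<lambda>x. cos (x / 2)"] by auto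
    have "cos (\<Theta> / 2) \<le> cos (z / 2)"
      using z that \<Theta> by (intro cos_monotone_0_pi_le) auto
    then show ?thesis using z by (simp add: mult.commute mult_left_mono)
  qed simp
  have main: "cos (\<Theta> / 2) * \<bar>sphere_dist x y - sphere_dist x' y'\<bar> \<le> \<bar>norm (x - y) - norm (x' - y')\<bar>"
    if xy: "x \<in> D" "y \<in> D" "x' \<in> D" "y' \<in> D" for x y x' y'
  proof -
    have "norm (x - y) = 2 * sin (sphere_dist x y / 2)" "norm (x' - y') = 2 * sin (sphere_dist x' y' / 2)"
      using xy D by (auto intro!: chord_eq_sin_half_angle)
    then show ?thesis
      using mono[of "sphere_dist x y" "sphere_dist x' y'"] mono[of "sphere_dist x' y'" "sphere_dist x y"]
        range[of x y] range[of x' y'] xy by (cases "sphere_dist x y \<le> sphere_dist x' y'") auto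
  qed
  show ?thesis
    by (rule that[of "1 / cos (\<Theta> / 2)"]) (use k main in \<open>auto simp: field_simps\<close>)
qed

lemma chord_le_sphere_dist:
  assumes "x \<in> sphere 0 1" "y \<in> sphere 0 1"
  shows "norm (x - y) \<le> sphere_dist x y"
  using chord_eq_sin_half_angle[OF assms] sphere_dist_nonneg[OF assms]
    sin_x_le_x[of "sphere_dist x y / 2"] by simp

text \<open>
  Points of the cap have height at least \<open>sin \<epsilon>\<close> and horizontal part of length at most \<open>cos \<epsilon>\<close>.
  The bound is \<open>- cos (2 * \<epsilon>)\<close>, larger than \<open>-1\<close>: the cap contains no nearly antipodal pairs.
\<close>

lemma polar_cap_inner_ge:
  fixes x y :: "(real ^ 'k) \<times> real"
  assumes "0 < \<epsilon>" "\<epsilon> < pi / 2" and "x \<in> polar_cap \<epsilon>" "y \<in> polar_cap \<epsilon>"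
  shows "2 * (sin \<epsilon>)\<^sup>2 - 1 \<le> x \<bullet> y"
proof -
  have height: "sin \<epsilon> \<le> snd z \<and> (norm (fst z))\<^sup>2 \<le> 1 - (sin \<epsilon>)\<^sup>2"
    if z: "z \<in> polar_cap \<epsilon>" for z :: "(real ^ 'k) \<times> real"
  proof -
    have zs: "z \<in> sphere 0 1" "arccos (snd z) < pi / 2 - \<epsilon>"
      using z by (auto simp: polar_cap_def sphere_dist_def north_pole_def inner_prod_def)
    then have sq: "(norm (fst z))\<^sup>2 + (snd z)\<^sup>2 = 1"
      by (simp add: norm_prod_def)
    then have "\<bar>snd z\<bar> \<le> 1" by (metis abs_square_le_1 le_add_same_cancel2 zero_le_power2)
    then have "snd z = cos (arccos (snd z))" "0 \<le> arccos (snd z)"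
      by (auto intro: arccos_lbound)
    then have "sin \<epsilon> \<le> snd z"
      using zs assms cos_monotone_0_pi_le[of "arccos (snd z)" "pi / 2 - \<epsilon>"]
      by (simp add: cos_diff)
    moreover have "0 \<le> sin \<epsilon>" using assms by (intro sin_ge_zero) auto
    ultimately have "(sin \<epsilon>)\<^sup>2 \<le> (snd z)\<^sup>2" by (intro power_mono)
    with sq \<open>sin \<epsilon> \<le> snd z\<close> show ?thesis by simp
  qed
  have s: "0 \<le> sin \<epsilon>" using assms by (intro sin_ge_zero) auto
  have "\<bar>fst x \<bullet> fst y\<bar> \<le> norm (fst x) * norm (fst y)" by (rule Cauchy_Schwarz_ineq2)
  also have "\<dots> \<le> ((norm (fst x))\<^sup>2 + (norm (fst y))\<^sup>2) / 2"
    using sum_squares_bound[of "norm (fst x)" "norm (fst y)"] by (simp add: field_simps)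
  also have "\<dots> \<le> 1 - (sin \<epsilon>)\<^sup>2" using height[OF assms(3)] height[OF assms(4)] by simp
  finally have "- (1 - (sin \<epsilon>)\<^sup>2) \<le> fst x \<bullet> fst y" by simp
  moreover have "(sin \<epsilon>)\<^sup>2 \<le> snd x * snd y"
    using height[OF assms(3)] height[OF assms(4)] s by (simp add: power2_eq_square mult_mono')
  ultimately show ?thesis by (simp add: inner_prod_def)
qed

section \<open>Growth of distances under Lipschitz interaction\<close>

text \<open>
  Let \<open>A\<close> be the supremum of \<open>norm (w s) * exp (- 4 L s)\<close>. The assumption bounds \<open>norm (w' s)\<close> by
  \<open>L * (A + m) * exp (4 L s)\<close>, and integration gives
  \<open>norm (w t - w 0) \<le> (A + m) / 4 * (exp (4 L t) - 1)\<close>. The rate \<open>4 L\<close> in the weight, in place of \<open>L\<close>, makes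
  the factor \<open>1 / 4\<close> appear, so that the resulting \<open>A \<le> norm (w 0) + (A + m) / 4\<close> can be solved for
  \<open>A\<close>. The bound \<open>R\<close> ensures that \<open>A\<close> is finite.
\<close>

lemma growth_of_difference:
  fixes w :: "real \<Rightarrow> 'a::real_normed_vector"
  assumes L: "0 < L" and m: "0 \<le> m" and bdd: "\<And>s. s \<in> {0..b} \<Longrightarrow> norm (w s) \<le> R"
    and w': "\<And>s. s \<in> {0..b} \<Longrightarrow> (w has_vector_derivative w' s) (at s within {0..b})"
    and le: "\<And>s. s \<in> {0..b} \<Longrightarrow> norm (w' s) \<le> L * (norm (w s) + m * exp (4 * L * s))"
    and t: "t \<in> {0..b}"
  shows "norm (w t - w 0) \<le> (norm (w 0) + m) / 3 * (exp (4 * L * t) - 1)"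
proof -
  define f where "f s = norm (w s) * exp (- (4 * L * s))" for s
  define A where "A = (SUP s\<in>{0..b}. f s)"
  have "f s \<le> R" if "s \<in> {0..b}" for s
  proof -
    have "f s \<le> norm (w s) * 1"
      unfolding f_def using that L by (intro mult_left_mono) auto
    with bdd[OF that] show ?thesis by simp
  qed
  then have A: "f s \<le> A" if "s \<in> {0..b}" for s
    unfolding A_def using that by (intro cSUP_upper bdd_aboveI2[where M = R]) auto
  have wA: "norm (w s) \<le> A * exp (4 * L * s)" if "s \<in> {0..b}" for s
    using A[OF that] by (simp add: f_def exp_minus field_simps)
  have "0 \<le> A" using A[of t] t by (simp add: f_def order_trans[rotated])
  have step: "norm (w s - w 0) \<le> (A + m) / 4 * (exp (4 * L * s) - 1)" if s: "s \<in> {0..b}" for s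
  proof (cases "s = 0")
    case False
    with s have "0 < s" by simp
    define \<phi> where "\<phi> r = (A + m) / 4 * exp (4 * L * r)" for r
    have "norm (w s - w 0) \<le> \<phi> s - \<phi> 0"
    proof (rule differentiable_bound_general[OF \<open>0 < s\<close>])
      have "continuous_on {0..b} w"
        unfolding continuous_on_eq_continuous_within
        using has_vector_derivative_continuous[OF w'] by blast
      then show "continuous_on {0..s} w" by (rule continuous_on_subset) (use s in auto)
      show "continuous_on {0..s} \<phi>" unfolding \<phi>_def by (intro continuous_intros)
      fix r assume r: "0 < r" "r < s"
      then have rb: "r \<in> {0..b}" using s by auto
      have "at r within {0..b} = at r" using r s by (intro at_within_interior) auto
      then show "(w has_vector_derivative w' r) (at r)" using w'[OF rb] by simp
      show "(\<phi> has_vector_derivative (L * ((A + m) * exp (4 * L * r)))) (at r)"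
        unfolding \<phi>_def has_real_derivative_iff_has_vector_derivative[symmetric]
        by (auto intro!: derivative_eq_intros)
      have "norm (w r) + m * exp (4 * L * r) \<le> (A + m) * exp (4 * L * r)"
        using wA[OF rb] by (simp add: algebra_simps)
      then show "norm (w' r) \<le> L * ((A + m) * exp (4 * L * r))"
        using le[OF rb] L by (meson mult_left_mono order_trans less_imp_le)
    qed
    then show ?thesis by (simp add: \<phi>_def algebra_simps)
  qed simp
  have "A \<le> norm (w 0) + (A + m) / 4"
    unfolding A_def
  proof (rule cSUP_least)
    show "{0..b} \<noteq> {}" using t by auto
    fix s assume s: "s \<in> {0..b}"
    have "norm (w s) \<le> norm (w 0) + norm (w s - w 0)"
      by (metis add.commute norm_triangle_sub)
    also have "\<dots> \<le> norm (w 0) * exp (4 * L * s) + (A + m) / 4 * exp (4 * L * s)"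
    proof (rule add_mono)
      have "norm (w 0) * 1 \<le> norm (w 0) * exp (4 * L * s)"
        using s L by (intro mult_left_mono) auto
      then show "norm (w 0) \<le> norm (w 0) * exp (4 * L * s)" by simp
      show "norm (w s - w 0) \<le> (A + m) / 4 * exp (4 * L * s)"
        using \<open>0 \<le> A\<close> m by (intro order_trans[OF step[OF s]] mult_left_mono) auto
    qed
    finally have "f s \<le> norm (w 0) + (A + m) / 4"
      by (simp add: f_def exp_minus field_simps)
    then show "f s \<le> norm (w 0) + ((SUP s\<in>{0..b}. f s) + m) / 4"
      unfolding A_def .
  qed
  then have "(A + m) / 4 \<le> (norm (w 0) + m) / 3" by (simp add: field_simps)
  moreover have "0 \<le> exp (4 * L * t) - 1" using t L by simp
  ultimately show ?thesis using step[OF t] by (meson mult_right_mono order_trans)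
qed

lemma measurable_into_restrictD:
  assumes "f \<in> M \<rightarrow>\<^sub>M restrict_space borel D"
  shows "f \<in> borel_measurable M" "\<And>z. z \<in> space M \<Longrightarrow> f z \<in> D"
  using assms by (auto simp: measurable_restrict_space2_iff Pi_iff)

lemma prob_measures_onD:
  assumes "M \<in> prob_measures_on D"
  shows "prob_space M" "sets M = sets (restrict_space borel D)" "space M = D"
  using assms sets_eq_imp_space_eq[of M "restrict_space borel D"]
  by (auto simp: prob_measures_on_def space_restrict_space)

lemma integrable_bounded_prob_space:
  fixes f :: "'b \<Rightarrow> 'c::{banach, second_countable_topology}"
  assumes "prob_space M" "f \<in> borel_measurable M" "\<And>z. z \<in> space M \<Longrightarrow> norm (f z) \<le> B"
  shows "integrable M f"
  using assms by (intro finite_measure.integrable_const_bound[of _ _ B] prob_space.finite_measure) auto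

text \<open>
  The growth estimates see the geometry only through a bounded domain and a kernel that is
  jointly Lipschitz for the ambient norm.
\<close>

locale lipschitz_interaction =
  fixes D :: "'a::euclidean_space set" and F :: "'a \<Rightarrow> 'a \<Rightarrow> 'a" and L :: real
  assumes bounded_D: "bounded D"
    and L_pos: "0 < L"
    and F_lipschitz: "\<lbrakk>x \<in> D; y \<in> D; x' \<in> D; y' \<in> D\<rbrakk> \<Longrightarrow>
      norm (F x y - F x' y') \<le> L * (norm (x - x') + norm (y - y'))"
begin

lemma measurable_F:
  assumes "x \<in> D"
  shows "F x \<in> borel_measurable (restrict_space borel D)"
proof (intro borel_measurable_continuous_on_restrict lipschitz_on_continuous_on[of L] lipschitz_onI)
  fix y y' assume "y \<in> D" "y' \<in> D"
  then show "dist (F x y) (F x y') \<le> L * dist y y'"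
    using F_lipschitz[of x y x y'] assms by (simp add: dist_norm)
qed (use L_pos in simp)

lemma diameter_bound:
  obtains R where "0 \<le> R" "\<And>x y. x \<in> D \<Longrightarrow> y \<in> D \<Longrightarrow> norm (x - y) \<le> R"
  using diameter_bounded_bound[OF bounded_D] diameter_ge_0[OF bounded_D]
  by (metis dist_norm)

lemma integrable_F:
  assumes M: "prob_space M" and p: "p \<in> M \<rightarrow>\<^sub>M restrict_space borel D" and x: "x \<in> D"
  shows "integrable M (\<lambda>z. F x (p z))"
proof -
  obtain R where R: "0 \<le> R" "\<And>x y. x \<in> D \<Longrightarrow> y \<in> D \<Longrightarrow> norm (x - y) \<le> R"
    using diameter_bound by blast
  have "norm (F x (p z)) \<le> norm (F x x) + L * R" if "z \<in> space M" for z
  proof -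
    have "p z \<in> D" using measurable_into_restrictD(2)[OF p that] .
    then have "norm (F x (p z) - F x x) \<le> L * norm (p z - x)"
      using F_lipschitz[of x "p z" x x] x by simp
    also have "\<dots> \<le> L * R" using R(2) x \<open>p z \<in> D\<close> L_pos by (intro mult_left_mono) auto
    finally show ?thesis using norm_triangle_sub[of "F x (p z)" "F x x"] by simp
  qed
  moreover have "(\<lambda>z. F x (p z)) \<in> borel_measurable M"
    using measurable_compose[OF p measurable_F[OF x]] .
  ultimately show ?thesis by (intro integrable_bounded_prob_space M)
qed

lemma integrable_norm_diff:
  assumes M: "prob_space M"
    and p: "p \<in> M \<rightarrow>\<^sub>M restrict_space borel D" and q: "q \<in> M \<rightarrow>\<^sub>M restrict_space borel D"
  shows "integrable M (\<lambda>z. norm (p z - q z))"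
proof -
  obtain R where R: "0 \<le> R" "\<And>x y. x \<in> D \<Longrightarrow> y \<in> D \<Longrightarrow> norm (x - y) \<le> R"
    using diameter_bound by blast
  have [measurable]: "p \<in> borel_measurable M" "q \<in> borel_measurable M"
    using p q measurable_into_restrictD by auto
  show ?thesis
    by (rule integrable_bounded_prob_space[OF M, of _ R])
      (use R measurable_into_restrictD(2)[OF p] measurable_into_restrictD(2)[OF q] in auto)
qed

text \<open>
  Both measures are realised as laws of random variables \<open>p\<close> and \<open>q\<close> on one probability space, so
  the difference of the two mean velocities is a single integral.
\<close>

lemma mean_field_lipschitz:
  assumes M: "prob_space M"
    and p: "p \<in> M \<rightarrow>\<^sub>M restrict_space borel D" and q: "q \<in> M \<rightarrow>\<^sub>M restrict_space borel D"
    and x: "x \<in> D" and y: "y \<in> D"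
  shows "norm ((\<integral>z. F x z \<partial>distr M (restrict_space borel D) p) -
      (\<integral>z. F y z \<partial>distr M (restrict_space borel D) q)) \<le> L * (norm (x - y) + (\<integral>z. norm (p z - q z) \<partial>M))"
proof -
  interpret prob_space M by (rule M)
  note int = integrable_F[OF M p x] integrable_F[OF M q y] integrable_norm_diff[OF M p q]
  have "(\<integral>z. F x z \<partial>distr M (restrict_space borel D) p) - (\<integral>z. F y z \<partial>distr M (restrict_space borel D) q)
      = (\<integral>z. F x (p z) - F y (q z) \<partial>M)"
    using int by (simp add: integral_distr p q measurable_F x y)
  also have "norm \<dots> \<le> (\<integral>z. norm (F x (p z) - F y (q z)) \<partial>M)"
    by (rule integral_norm_bound)
  also have "\<dots> \<le> (\<integral>z. L * (norm (x - y) + norm (p z - q z)) \<partial>M)"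
    using int measurable_into_restrictD(2)[OF p] measurable_into_restrictD(2)[OF q] x y
    by (intro integral_mono F_lipschitz) auto
  also have "\<dots> = L * (norm (x - y) + (\<integral>z. norm (p z - q z) \<partial>M))"
    using int by (simp add: prob_space)
  finally show ?thesis .
qed

text \<open>
  The trajectories of the velocity field generated by the curve of measures \<open>\<mu>\<close>. The derivative
  is taken within \<open>{0..b}\<close>, hence one-sided at both end points.
\<close>

definition driven_by :: "(real \<Rightarrow> 'a measure) \<Rightarrow> real \<Rightarrow> (real \<Rightarrow> 'a) \<Rightarrow> bool" where
  "driven_by \<mu> b x \<longleftrightarrow> (\<forall>s\<in>{0..b}. x s \<in> D \<and>
    (x has_vector_derivative - (\<integral>y. F (x s) y \<partial>\<mu> s)) (at s within {0..b}))"

lemma driven_curves_spread: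
  fixes M :: "'b measure"
  assumes M: "prob_space M"
    and p: "\<And>s. s \<in> {0..b} \<Longrightarrow> p s \<in> M \<rightarrow>\<^sub>M restrict_space borel D"
    and q: "\<And>s. s \<in> {0..b} \<Longrightarrow> q s \<in> M \<rightarrow>\<^sub>M restrict_space borel D"
    and x: "driven_by (\<lambda>s. distr M (restrict_space borel D) (p s)) b x"
    and y: "driven_by (\<lambda>s. distr M (restrict_space borel D) (q s)) b y"
    and m: "0 \<le> m" "\<And>s. s \<in> {0..b} \<Longrightarrow> (\<integral>z. norm (p s z - q s z) \<partial>M) \<le> m * exp (4 * L * s)"
    and t: "t \<in> {0..b}"
  shows "norm ((x t - y t) - (x 0 - y 0)) \<le> (norm (x 0 - y 0) + m) / 3 * (exp (4 * L * t) - 1)"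
proof -
  obtain R where R: "\<And>x y. x \<in> D \<Longrightarrow> y \<in> D \<Longrightarrow> norm (x - y) \<le> R"
    using diameter_bound by blast
  define V where "V r z s = - (\<integral>y. F z y \<partial>distr M (restrict_space borel D) (r s))"
    for r :: "real \<Rightarrow> 'b \<Rightarrow> 'a" and z s
  have xD: "x s \<in> D" "y s \<in> D" if "s \<in> {0..b}" for s
    using x y that by (auto simp: driven_by_def)
  show ?thesis
  proof (rule growth_of_difference[where w = "\<lambda>s. x s - y s" and w' = "\<lambda>s. V p (x s) s - V q (y s) s"
        and R = R, OF L_pos m(1) _ _ _ t])
    fix s assume s: "s \<in> {0..b}"
    show "norm (x s - y s) \<le> R" using R xD s by blast
    show "((\<lambda>s. x s - y s) has_vector_derivative V p (x s) s - V q (y s) s) (at s within {0..b})"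
      using x y s unfolding driven_by_def V_def by (intro has_vector_derivative_diff) blast+
    have "norm (V p (x s) s - V q (y s) s) \<le> L * (norm (x s - y s) + (\<integral>z. norm (p s z - q s z) \<partial>M))"
      using mean_field_lipschitz[OF M p[OF s] q[OF s] xD[OF s]] by (simp add: V_def norm_minus_commute)
    also have "\<dots> \<le> L * (norm (x s - y s) + m * exp (4 * L * s))"
      using m(2)[OF s] L_pos by (intro mult_left_mono add_left_mono) auto
    finally show "norm (V p (x s) s - V q (y s) s) \<le> L * (norm (x s - y s) + m * exp (4 * L * s))" .
  qed
qed

text \<open>
  Both curves see the same measures, so the mean distance \<open>m\<close> in the growth estimate is \<open>0\<close>. The
  lemma serves to show that the flow is measurable in the initial point.
\<close>

lemma flow_lipschitz_in_initial_point:
  assumes \<mu>: "\<And>s. s \<in> {0..b} \<Longrightarrow> \<mu> s \<in> prob_measures_on D"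
    and x: "driven_by \<mu> b x" and y: "driven_by \<mu> b y" and t: "t \<in> {0..b}"
  shows "norm (x t - y t) \<le> exp (4 * L * t) * norm (x 0 - y 0)"
proof -
  obtain R where R: "\<And>x y. x \<in> D \<Longrightarrow> y \<in> D \<Longrightarrow> norm (x - y) \<le> R"
    using diameter_bound by blast
  define V where "V z s = - (\<integral>y. F z y \<partial>\<mu> s)" for z s
  have xD: "x s \<in> D" "y s \<in> D" if "s \<in> {0..b}" for s
    using x y that by (auto simp: driven_by_def)
  have "norm ((x t - y t) - (x 0 - y 0)) \<le> (norm (x 0 - y 0) + 0) / 3 * (exp (4 * L * t) - 1)"
  proof (rule growth_of_difference[where w = "\<lambda>s. x s - y s" and w' = "\<lambda>s. V (x s) s - V (y s) s"
        and R = R, OF L_pos order_refl _ _ _ t])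
    fix s assume s: "s \<in> {0..b}"
    show "norm (x s - y s) \<le> R" using R xD s by blast
    show "((\<lambda>s. x s - y s) has_vector_derivative V (x s) s - V (y s) s) (at s within {0..b})"
      using x y s unfolding driven_by_def V_def by (intro has_vector_derivative_diff) blast+
    note \<mu>s = prob_measures_onD[OF \<mu>[OF s]]
    have id: "(\<lambda>z. z) \<in> \<mu> s \<rightarrow>\<^sub>M restrict_space borel D"
      by (rule measurable_ident_sets) (rule \<mu>s)
    have "distr (\<mu> s) (restrict_space borel D) (\<lambda>z. z) = \<mu> s"
      using \<mu>s by (intro distr_id2) auto
    then show "norm (V (x s) s - V (y s) s) \<le> L * (norm (x s - y s) + 0 * exp (4 * L * s))"
      using mean_field_lipschitz[OF \<mu>s(1) id id xD[OF s]] by (simp add: V_def norm_minus_commute)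
  qed
  moreover have "norm (x t - y t) \<le> norm (x 0 - y 0) + norm ((x t - y t) - (x 0 - y 0))"
    by (metis add.commute norm_triangle_sub)
  moreover have "norm (x 0 - y 0) / 3 * (exp (4 * L * t) - 1) \<le> norm (x 0 - y 0) * (exp (4 * L * t) - 1)"
    using t L_pos by (intro mult_right_mono) auto
  ultimately show ?thesis by (simp add: algebra_simps)
qed

text \<open>
  Here \<open>p\<close> and \<open>q\<close> are random trajectories, each driven by its own law. Let \<open>E s\<close> be their mean
  distance and \<open>m\<close> the supremum of \<open>E s * exp (- 4 L s)\<close>. The estimate for single trajectories,
  averaged over \<open>M\<close>, bounds \<open>m\<close> by \<open>E 0 + (E 0 + m) / 3\<close>, that is, \<open>m \<le> 2 * E 0\<close>. Suprema over
  time take the place of an integral inequality in time, so that all integrals are over \<open>M\<close> alone.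
\<close>

lemma coupled_distance_growth:
  assumes M: "prob_space M"
    and p: "\<And>s. s \<in> {0..b} \<Longrightarrow> p s \<in> M \<rightarrow>\<^sub>M restrict_space borel D"
    and q: "\<And>s. s \<in> {0..b} \<Longrightarrow> q s \<in> M \<rightarrow>\<^sub>M restrict_space borel D"
    and pd: "AE z in M. driven_by (\<lambda>s. distr M (restrict_space borel D) (p s)) b (\<lambda>s. p s z)"
    and qd: "AE z in M. driven_by (\<lambda>s. distr M (restrict_space borel D) (q s)) b (\<lambda>s. q s z)"
  shows "AE z in M. \<forall>t\<in>{0..b}. norm ((p t z - q t z) - (p 0 z - q 0 z)) \<le>
    (norm (p 0 z - q 0 z) + 2 * (\<integral>z. norm (p 0 z - q 0 z) \<partial>M)) / 3 * (exp (4 * L * t) - 1)"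
proof (cases "0 \<le> b")
  case True
  interpret prob_space M by (rule M)
  obtain R where R: "0 \<le> R" "\<And>x y. x \<in> D \<Longrightarrow> y \<in> D \<Longrightarrow> norm (x - y) \<le> R"
    using diameter_bound by blast
  note int = integrable_norm_diff[OF M p q]
  define E where "E s = (\<integral>z. norm (p s z - q s z) \<partial>M)" for s
  define m where "m = (SUP s\<in>{0..b}. E s * exp (- (4 * L * s)))"
  have E_nonneg: "0 \<le> E s" for s by (simp add: E_def)
  have "E s * exp (- (4 * L * s)) \<le> R" if s: "s \<in> {0..b}" for s
  proof -
    have "E s \<le> (\<integral>z. R \<partial>M)"
      unfolding E_def using int[OF s s] R measurable_into_restrictD(2)[OF p[OF s]] measurable_into_restrictD(2)[OF q[OF s]]
      by (intro integral_mono) auto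
    then have "E s \<le> R" by (simp add: prob_space)
    moreover have "exp (- (4 * L * s)) \<le> 1" using s L_pos by simp
    ultimately have "E s * exp (- (4 * L * s)) \<le> R * 1" using E_nonneg R by (intro mult_mono) auto
    then show ?thesis by simp
  qed
  then have m_upper: "E s * exp (- (4 * L * s)) \<le> m" if "s \<in> {0..b}" for s
    unfolding m_def using that by (intro cSUP_upper bdd_aboveI2[where M = R]) auto
  then have Em: "E s \<le> m * exp (4 * L * s)" if "s \<in> {0..b}" for s
    using m_upper[OF that] by (simp add: exp_minus field_simps)
  have "0 \<le> m" using m_upper[of 0] E_nonneg[of 0] True by simp
  have "norm ((p t z - q t z) - (p 0 z - q 0 z)) \<le>
      (norm (p 0 z - q 0 z) + m) / 3 * (exp (4 * L * t) - 1)"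
    if "driven_by (\<lambda>s. distr M (restrict_space borel D) (p s)) b (\<lambda>s. p s z)"
      "driven_by (\<lambda>s. distr M (restrict_space borel D) (q s)) b (\<lambda>s. q s z)" "t \<in> {0..b}" for t z
    by (rule driven_curves_spread[OF M p q that(1,2) \<open>0 \<le> m\<close> Em[unfolded E_def] that(3)])
  then have spread: "AE z in M. \<forall>t\<in>{0..b}. norm ((p t z - q t z) - (p 0 z - q 0 z)) \<le>
      (norm (p 0 z - q 0 z) + m) / 3 * (exp (4 * L * t) - 1)"
    using pd qd by (auto elim!: eventually_elim2)
  have "m \<le> E 0 + (E 0 + m) / 3"
    unfolding m_def
  proof (rule cSUP_least)
    show "{0..b} \<noteq> {}" using True by simp
    fix t assume t: "t \<in> {0..b}"
    have 0: "0 \<in> {0..b}" using True by simp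
    let ?e = "exp (4 * L * t)"
    have e1: "1 \<le> ?e" using t L_pos by simp
    have "E t \<le> (\<integral>z. norm (p 0 z - q 0 z) + (norm (p 0 z - q 0 z) + m) / 3 * (?e - 1) \<partial>M)"
      unfolding E_def
    proof (rule integral_mono_AE)
      show "integrable M (\<lambda>z. norm (p t z - q t z))" using int t by blast
      show "integrable M (\<lambda>z. norm (p 0 z - q 0 z) + (norm (p 0 z - q 0 z) + m) / 3 * (?e - 1))"
        using int[OF 0 0] by auto
      show "AE z in M. norm (p t z - q t z) \<le>
          norm (p 0 z - q 0 z) + (norm (p 0 z - q 0 z) + m) / 3 * (?e - 1)"
        using spread
      proof eventually_elim
        case (elim z)
        then show ?case
          using t norm_triangle_sub[of "p t z - q t z" "p 0 z - q 0 z"] by force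
      qed
    qed
    also have "\<dots> = E 0 + (E 0 + m) / 3 * (?e - 1)"
      using int[OF 0 0] by (simp add: E_def prob_space)
    also have "\<dots> \<le> E 0 * ?e + (E 0 + m) / 3 * ?e"
      using e1 E_nonneg[of 0] \<open>0 \<le> m\<close>
      by (intro add_mono mult_left_mono) (auto simp: mult_le_cancel_left1 not_less)
    finally show "E t * exp (- (4 * L * t)) \<le> E 0 + (E 0 + (SUP s\<in>{0..b}. E s * exp (- (4 * L * s)))) / 3"
      unfolding m_def[symmetric] by (simp add: exp_minus field_simps)
  qed
  then have m2: "m \<le> 2 * E 0" by (simp add: field_simps)
  show ?thesis
    using spread
  proof eventually_elim
    case (elim z)
    have "(norm (p 0 z - q 0 z) + m) / 3 * (exp (4 * L * t) - 1)
        \<le> (norm (p 0 z - q 0 z) + 2 * E 0) / 3 * (exp (4 * L * t) - 1)" if "t \<in> {0..b}" for t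
      using m2 that L_pos by (intro mult_right_mono divide_right_mono) auto
    then show ?case using elim unfolding E_def by (meson order_trans)
  qed
qed simp

end

section \<open>Supports, push-forwards and couplings\<close>

text \<open>
  Every point outside the support has a null neighbourhood, which can be taken from a countable
  base.
\<close>

lemma compl_measure_support_null:
  fixes M :: "'a::second_countable_topology measure"
  assumes sets_M: "sets M = sets (restrict_space borel D)"
  shows "space M - measure_support M \<in> null_sets M"
proof -
  obtain B :: "'a set set" where B: "countable B" "topological_basis B"
    using ex_countable_basis by blast
  have sp: "space M = D"
    using sets_eq_imp_space_eq[OF sets_M] by (simp add: space_restrict_space)
  have meas: "U \<inter> space M \<in> sets M" if "open U" for U
    using that unfolding sets_M sp by (auto simp: sets_restrict_space)
  define N where "N = (\<Union>b\<in>{b\<in>B. b \<inter> space M \<in> null_sets M}. b \<inter> space M)"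
  have "N \<in> null_sets M"
    unfolding N_def using B by (intro null_sets_UN') (auto intro: countable_subset)
  moreover have "space M - measure_support M = N"
  proof (intro equalityI subsetI)
    fix x assume "x \<in> space M - measure_support M"
    then obtain U where U: "x \<in> space M" "open U" "x \<in> U" "emeasure M (U \<inter> space M) = 0"
      by (auto simp: measure_support_def zero_less_iff_neq_zero)
    then obtain b where b: "b \<in> B" "x \<in> b" "b \<subseteq> U"
      using topological_basisE[OF B(2)] by metis
    have "U \<inter> space M \<in> null_sets M" using U meas by (intro null_setsI) auto
    moreover have "b \<inter> space M \<in> sets M"
      using meas B(2) b topological_basis_open by blast
    ultimately have "b \<inter> space M \<in> null_sets M"
      using b by (blast intro: null_sets_subset)
    then show "x \<in> N" using b U by (auto simp: N_def)
  next
    fix x assume "x \<in> N"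
    then obtain b where b: "b \<in> B" "b \<inter> space M \<in> null_sets M" "x \<in> b" "x \<in> space M"
      by (auto simp: N_def)
    then have "open b" "emeasure M (b \<inter> space M) = 0"
      using B(2) topological_basis_open by auto
    then show "x \<in> space M - measure_support M"
      using b by (auto simp: measure_support_def)
  qed
  ultimately show ?thesis by simp
qed

lemma measure_support_sets:
  fixes M :: "'a::second_countable_topology measure"
  assumes "sets M = sets (restrict_space borel D)"
  shows "measure_support M \<in> sets M"
proof -
  have "measure_support M = space M - (space M - measure_support M)"
    by (auto simp: measure_support_def)
  then show ?thesis
    using compl_measure_support_null[OF assms] by (metis null_setsD2 sets.compl_sets)
qed

lemma AE_measure_support:
  fixes M :: "'a::second_countable_topology measure"
  assumes "sets M = sets (restrict_space borel D)"
  shows "AE x in M. x \<in> measure_support M"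
  by (rule AE_I'[OF compl_measure_support_null[OF assms]]) auto

lemma distr_restrict_space_eq_extension:
  assumes S: "S \<in> sets M" "AE x in M. x \<in> S"
    and h: "h \<in> M \<rightarrow>\<^sub>M N" "\<And>x. x \<in> S \<Longrightarrow> h x = f x"
  shows "distr (restrict_space M S) N f = distr M N h"
proof (rule measure_eqI)
  have SM: "S \<subseteq> space M" using S sets.sets_into_space by blast
  have hm: "h \<in> restrict_space M S \<rightarrow>\<^sub>M N" using h(1) by (rule measurable_restrict_space1)
  have f: "f \<in> restrict_space M S \<rightarrow>\<^sub>M N"
    by (rule measurable_cong[THEN iffD1, OF _ hm]) (simp add: h space_restrict_space)
  fix A assume "A \<in> sets (distr (restrict_space M S) N f)"
  then have A: "A \<in> sets N" by simp
  have "f -` A \<inter> space (restrict_space M S) = h -` A \<inter> space M \<inter> S"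
    using SM h by (auto simp: space_restrict_space)
  then have "emeasure (distr (restrict_space M S) N f) A = emeasure M (h -` A \<inter> space M \<inter> S)"
    using A S SM f by (simp add: emeasure_distr emeasure_restrict_space)
  also have "\<dots> = emeasure M (h -` A \<inter> space M)"
    using S measurable_sets[OF h(1) A] by (intro emeasure_eq_AE) auto
  finally show "emeasure (distr (restrict_space M S) N f) A = emeasure (distr M N h) A"
    using A h(1) by (simp add: emeasure_distr)
qed simp

lemma couplingD:
  assumes "\<pi> \<in> couplings \<rho> \<sigma>" "prob_space \<rho>"
  shows "fst \<in> \<pi> \<rightarrow>\<^sub>M \<rho>" "snd \<in> \<pi> \<rightarrow>\<^sub>M \<sigma>" "distr \<pi> \<rho> fst = \<rho>" "distr \<pi> \<sigma> snd = \<sigma>" "prob_space \<pi>"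
proof -
  have sets: "sets \<pi> = sets (\<rho> \<Otimes>\<^sub>M \<sigma>)" and d: "distr \<pi> \<rho> fst = \<rho>" "distr \<pi> \<sigma> snd = \<sigma>"
    using assms by (auto simp: couplings_def)
  show f: "fst \<in> \<pi> \<rightarrow>\<^sub>M \<rho>" and "snd \<in> \<pi> \<rightarrow>\<^sub>M \<sigma>"
    by (simp_all add: measurable_cong_sets[OF sets refl])
  show "prob_space \<pi>"
    using prob_space_distrD[OF f] d assms by simp
qed (use assms in \<open>auto simp: couplings_def\<close>)

lemma coupling_push_forward:
  assumes "p \<in> M \<rightarrow>\<^sub>M N1" "q \<in> M \<rightarrow>\<^sub>M N2" "\<rho> = distr M N1 p" "\<sigma> = distr M N2 q"
  shows "distr M (\<rho> \<Otimes>\<^sub>M \<sigma>) (\<lambda>z. (p z, q z)) \<in> couplings \<rho> \<sigma>"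
proof -
  have [measurable]: "p \<in> M \<rightarrow>\<^sub>M \<rho>" "q \<in> M \<rightarrow>\<^sub>M \<sigma>" using assms by auto
  have "distr (distr M (\<rho> \<Otimes>\<^sub>M \<sigma>) (\<lambda>z. (p z, q z))) \<rho> fst = distr M \<rho> p"
    "distr (distr M (\<rho> \<Otimes>\<^sub>M \<sigma>) (\<lambda>z. (p z, q z))) \<sigma> snd = distr M \<sigma> q"
    by (simp_all add: distr_distr comp_def)
  moreover have "distr M \<rho> p = \<rho>" "distr M \<sigma> q = \<sigma>"
    using assms by (auto intro!: distr_cong)
  ultimately show ?thesis by (simp add: couplings_def)
qed

lemma couplings_nonempty:
  assumes "prob_space \<rho>" "prob_space \<sigma>"
  shows "couplings \<rho> \<sigma> \<noteq> {}"
proof -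
  interpret pair_prob_space \<rho> \<sigma>
    using assms by (simp add: pair_prob_space_def pair_sigma_finite_def prob_space_imp_sigma_finite)
  have "distr (\<rho> \<Otimes>\<^sub>M \<sigma>) \<rho> fst = \<rho>"
    using assms(2) by (rule prob_space.distr_pair_fst)
  moreover have "distr (\<rho> \<Otimes>\<^sub>M \<sigma>) \<sigma> snd = distr (distr (\<sigma> \<Otimes>\<^sub>M \<rho>) (\<rho> \<Otimes>\<^sub>M \<sigma>) (\<lambda>(x, y). (y, x))) \<sigma> snd"
    using distr_pair_swap by simp
  moreover have "\<dots> = distr (\<sigma> \<Otimes>\<^sub>M \<rho>) \<sigma> fst"
    by (subst distr_distr) (auto intro!: distr_cong)
  moreover have "\<dots> = \<sigma>"
    using assms(1) by (rule prob_space.distr_pair_fst)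
  ultimately have "\<rho> \<Otimes>\<^sub>M \<sigma> \<in> couplings \<rho> \<sigma>" by (simp add: couplings_def)
  then show ?thesis by blast
qed

lemma W1_le_coupling_cost:
  fixes \<rho> \<sigma> :: "'a::euclidean_space measure"
  assumes "space \<rho> \<subseteq> sphere 0 1" "space \<sigma> \<subseteq> sphere 0 1" "\<pi> \<in> couplings \<rho> \<sigma>"
  shows "W1 \<rho> \<sigma> \<le> (\<integral>z. sphere_dist (fst z) (snd z) \<partial>\<pi>)"
  unfolding W1_def
proof (rule cINF_lower[OF bdd_belowI2[where m = 0] assms(3)])
  fix \<pi>' assume "\<pi>' \<in> couplings \<rho> \<sigma>"
  then have "space \<pi>' = space \<rho> \<times> space \<sigma>"
    using sets_eq_imp_space_eq[of \<pi>' "\<rho> \<Otimes>\<^sub>M \<sigma>"] by (simp add: couplings_def space_pair_measure)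
  then show "0 \<le> (\<integral>z. sphere_dist (fst z) (snd z) \<partial>\<pi>')"
    using assms by (intro Bochner_Integration.integral_nonneg sphere_dist_nonneg) auto
qed

text \<open>
  Outside \<open>{-1..1}\<close> the values of \<open>arccos\<close> are unspecified. The inner product is therefore treated
  as a map into that interval, where \<open>arccos\<close> is continuous.
\<close>

lemma measurable_sphere_dist:
  fixes p q :: "'b \<Rightarrow> 'a::euclidean_space"
  assumes "D \<subseteq> sphere 0 1" and p: "p \<in> M \<rightarrow>\<^sub>M restrict_space borel D" and q: "q \<in> M \<rightarrow>\<^sub>M restrict_space borel D"
  shows "(\<lambda>z. sphere_dist (p z) (q z)) \<in> borel_measurable M"
proof -
  have [measurable]: "p \<in> borel_measurable M" "q \<in> borel_measurable M"
    using p q measurable_into_restrictD by auto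
  have "(\<lambda>z. p z \<bullet> q z) \<in> M \<rightarrow>\<^sub>M restrict_space borel {-1..1}"
    using measurable_into_restrictD(2)[OF p, THEN subsetD[OF assms(1)]]
      measurable_into_restrictD(2)[OF q, THEN subsetD[OF assms(1)]]
    by (intro measurable_restrict_space2 Pi_I inner_sphere_bounds) simp_all
  moreover have "arccos \<in> borel_measurable (restrict_space borel {-1..1})"
    by (intro borel_measurable_continuous_on_restrict continuous_on_arccos')
  ultimately show ?thesis
    unfolding sphere_dist_def by (rule measurable_compose)
qed

section \<open>Stability of weak solutions\<close>

text \<open>
  A coupling of the initial measures lives on all of \<open>D \<times> D\<close>, whereas a flow is determined only
  on the supports. The identity is used elsewhere because it keeps points in \<open>D\<close> and agrees with
  every flow at time \<open>0\<close>.
\<close>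

definition extend_flow :: "(real \<Rightarrow> 'a \<Rightarrow> 'a) \<Rightarrow> 'a set \<Rightarrow> real \<Rightarrow> 'a \<Rightarrow> 'a" where
  "extend_flow \<Psi> S t x = (if x \<in> S then \<Psi> t x else x)"

context lipschitz_interaction
begin

lemma measurable_extend_flow:
  assumes \<rho>0: "\<rho>\<^sub>0 \<in> prob_measures_on D"
    and \<mu>: "\<And>s. s \<in> {0..b} \<Longrightarrow> \<mu> s \<in> prob_measures_on D"
    and S: "S \<in> sets \<rho>\<^sub>0"
    and \<Psi>: "\<And>x. x \<in> S \<Longrightarrow> \<Psi> 0 x = x \<and> driven_by \<mu> b (\<lambda>s. \<Psi> s x)"
    and t: "t \<in> {0..b}"
  shows "extend_flow \<Psi> S t \<in> \<rho>\<^sub>0 \<rightarrow>\<^sub>M restrict_space borel D"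
proof (rule measurable_restrict_space2)
  note \<rho>0D = prob_measures_onD[OF \<rho>0]
  have SD: "S \<subseteq> D" using S sets.sets_into_space \<rho>0D by blast
  show "extend_flow \<Psi> S t \<in> space \<rho>\<^sub>0 \<rightarrow> D"
    using \<Psi> t \<rho>0D by (auto simp: extend_flow_def driven_by_def)
  have "(exp (4 * L * t))-lipschitz_on S (\<Psi> t)"
  proof (rule lipschitz_onI)
    fix x y assume xy: "x \<in> S" "y \<in> S"
    then show "dist (\<Psi> t x) (\<Psi> t y) \<le> exp (4 * L * t) * dist x y"
      using flow_lipschitz_in_initial_point[OF \<mu> \<Psi>[OF xy(1), THEN conjunct2] \<Psi>[OF xy(2), THEN conjunct2] t]
        \<Psi> by (simp add: dist_norm)
  qed simp
  then have "\<Psi> t \<in> borel_measurable (restrict_space borel S)"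
    by (intro borel_measurable_continuous_on_restrict lipschitz_on_continuous_on)
  moreover have "sets (restrict_space \<rho>\<^sub>0 S) = sets (restrict_space borel S)"
  proof -
    have "sets (restrict_space \<rho>\<^sub>0 S) = sets (restrict_space (restrict_space borel D) S)"
      by (rule sets_restrict_space_cong) (rule \<rho>0D)
    also have "\<dots> = sets (restrict_space borel S)"
      using SD by (simp add: sets_restrict_restrict_space inf.absorb2)
    finally show ?thesis .
  qed
  ultimately have "\<Psi> t \<in> borel_measurable (restrict_space \<rho>\<^sub>0 S)"
    by (simp cong: measurable_cong_sets)
  moreover have "(\<lambda>x. x) \<in> borel_measurable (restrict_space \<rho>\<^sub>0 {x. x \<notin> S})"
    by (intro measurable_restrict_space1)
      (use \<rho>0D in \<open>auto intro: measurable_into_restrictD(1) measurable_ident_sets\<close>)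
  moreover have "{x \<in> space \<rho>\<^sub>0. x \<in> S} \<in> sets \<rho>\<^sub>0"
    using S sets.sets_into_space[OF S] by (simp add: Collect_conj_eq Int_absorb1)
  ultimately show "extend_flow \<Psi> S t \<in> borel_measurable \<rho>\<^sub>0"
    unfolding extend_flow_def[abs_def] by (subst measurable_If_restrict_space_iff) auto
qed

end

text \<open>
  A weak solution seen on a compact time interval: its flow becomes a family of measurable maps
  \<open>P s\<close> on the whole of \<open>D\<close>, at the cost of following the velocity field only almost surely.
\<close>

lemma (in lipschitz_interaction) weak_solution_as_flow:
  assumes K: "\<And>x y. x \<in> D \<Longrightarrow> y \<in> D \<Longrightarrow> sphere_grad (\<lambda>z. K z y) x = F x y"
    and sol: "weak_solution K D T \<rho>\<^sub>0 \<rho>" and \<rho>0: "\<rho>\<^sub>0 \<in> prob_measures_on D"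
    and b: "ereal b < T"
  obtains P where "\<And>s. s \<in> {0..b} \<Longrightarrow> P s \<in> \<rho>\<^sub>0 \<rightarrow>\<^sub>M restrict_space borel D"
    "\<And>x. P 0 x = x"
    "\<And>s. s \<in> {0..b} \<Longrightarrow> \<rho> s = distr \<rho>\<^sub>0 (restrict_space borel D) (P s)"
    "AE x in \<rho>\<^sub>0. driven_by \<rho> b (\<lambda>s. P s x)"
proof -
  note \<rho>0D = prob_measures_onD[OF \<rho>0]
  define S where "S = measure_support \<rho>\<^sub>0"
  have S: "S \<in> sets \<rho>\<^sub>0" "AE x in \<rho>\<^sub>0. x \<in> S"
    unfolding S_def using \<rho>0D(2) by (rule measure_support_sets AE_measure_support)+
  have sub: "{0..b} \<subseteq> time_interval T"
  proof
    fix s assume "s \<in> {0..b}"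
    then have "0 \<le> s" "ereal s \<le> ereal b" by auto
    with b show "s \<in> time_interval T"
      unfolding time_interval_def using le_less_trans by blast
  qed
  obtain \<Psi> where fl: "is_flow_map (velocity K \<rho>) D S T \<Psi>"
    and push: "\<And>t. t \<in> time_interval T \<Longrightarrow>
      \<rho> t = distr (restrict_space \<rho>\<^sub>0 S) (restrict_space borel D) (\<Psi> t)"
    using sol unfolding weak_solution_def S_def by blast
  have \<rho>P: "\<rho> t \<in> prob_measures_on D" if "t \<in> {0..b}" for t
    using sol sub that unfolding weak_solution_def by blast
  have \<Psi>: "\<Psi> 0 x = x \<and> driven_by \<rho> b (\<lambda>s. \<Psi> s x)" if x: "x \<in> S" for x
    unfolding driven_by_def
  proof (intro conjI ballI)
    show "\<Psi> 0 x = x" using fl x by (auto simp: is_flow_map_def)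
    fix s assume s: "s \<in> {0..b}"
    then show D: "\<Psi> s x \<in> D" using fl x sub by (auto simp: is_flow_map_def)
    have "((\<lambda>s. \<Psi> s x) has_vector_derivative velocity K \<rho> (\<Psi> s x) s) (at s within {0..b})"
      by (rule has_vector_derivative_within_subset[OF _ sub])
        (use fl x sub s in \<open>auto simp: is_flow_map_def\<close>)
    moreover have "velocity K \<rho> (\<Psi> s x) s = - (\<integral>y. F (\<Psi> s x) y \<partial>\<rho> s)"
      unfolding velocity_def using K D prob_measures_onD(3)[OF \<rho>P[OF s]]
      by (auto intro!: Bochner_Integration.integral_cong)
    ultimately show "((\<lambda>s. \<Psi> s x) has_vector_derivative - (\<integral>y. F (\<Psi> s x) y \<partial>\<rho> s)) (at s within {0..b})"
      by simp
  qed
  have meas: "extend_flow \<Psi> S s \<in> \<rho>\<^sub>0 \<rightarrow>\<^sub>M restrict_space borel D" if "s \<in> {0..b}" for s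
    using measurable_extend_flow[OF \<rho>0 \<rho>P S(1) \<Psi> that] .
  show ?thesis
  proof (rule that[of "extend_flow \<Psi> S"])
    show "extend_flow \<Psi> S s \<in> \<rho>\<^sub>0 \<rightarrow>\<^sub>M restrict_space borel D" if "s \<in> {0..b}" for s
      using meas that .
    show "extend_flow \<Psi> S 0 x = x" for x
      using \<Psi> by (auto simp: extend_flow_def)
    show "\<rho> s = distr \<rho>\<^sub>0 (restrict_space borel D) (extend_flow \<Psi> S s)" if s: "s \<in> {0..b}" for s
      using push[of s] distr_restrict_space_eq_extension[OF S meas[OF s], of "\<Psi> s"] sub s
      by (auto simp: extend_flow_def)
    show "AE x in \<rho>\<^sub>0. driven_by \<rho> b (\<lambda>s. extend_flow \<Psi> S s x)"
      using S(2) by eventually_elim (use \<Psi> in \<open>simp add: extend_flow_def\<close>)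
  qed
qed

text \<open>
  For a coupling \<open>\<pi>\<close> of the initial measures, the maps \<open>p s\<close> and \<open>q s\<close> that move its two
  components are random trajectories driven by their own laws \<open>\<rho> s\<close> and \<open>\<sigma> s\<close>. Their law at
  time \<open>t\<close> is an admissible coupling, whose cost exceeds that of \<open>\<pi>\<close> by at most \<open>M\<close> times the mean
  growth of the chords.
\<close>

lemma (in lipschitz_interaction) W1_stability:
  assumes D: "D \<subseteq> sphere 0 1"
    and M: "0 < M" "\<And>x y x' y'. \<lbrakk>x \<in> D; y \<in> D; x' \<in> D; y' \<in> D\<rbrakk> \<Longrightarrow>
      \<bar>sphere_dist x y - sphere_dist x' y'\<bar> \<le> M * \<bar>norm (x - y) - norm (x' - y')\<bar>"
    and K: "\<And>x y. x \<in> D \<Longrightarrow> y \<in> D \<Longrightarrow> sphere_grad (\<lambda>z. K z y) x = F x y"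
    and \<rho>0: "\<rho>\<^sub>0 \<in> prob_measures_on D" and \<sigma>0: "\<sigma>\<^sub>0 \<in> prob_measures_on D"
    and \<rho>: "weak_solution K D T \<rho>\<^sub>0 \<rho>" and \<sigma>: "weak_solution K D T \<sigma>\<^sub>0 \<sigma>"
    and t: "0 \<le> t" "ereal t < T"
  shows "W1 (\<rho> t) (\<sigma> t) \<le> (1 + M * (exp (4 * L * t) - 1)) * W1 \<rho>\<^sub>0 \<sigma>\<^sub>0"
proof -
  let ?B = "restrict_space borel D"
  let ?r = "1 + M * (exp (4 * L * t) - 1)"
  have tt: "t \<in> {0..t}" "0 \<in> {0..t}" using t by auto
  have e: "0 \<le> exp (4 * L * t) - 1" using t L_pos by simp
  obtain P where P: "\<And>s. s \<in> {0..t} \<Longrightarrow> P s \<in> \<rho>\<^sub>0 \<rightarrow>\<^sub>M ?B" "\<And>x. P 0 x = x"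
    "\<And>s. s \<in> {0..t} \<Longrightarrow> \<rho> s = distr \<rho>\<^sub>0 ?B (P s)" "AE x in \<rho>\<^sub>0. driven_by \<rho> t (\<lambda>s. P s x)"
    using weak_solution_as_flow[OF K \<rho> \<rho>0 t(2)] by blast
  obtain Q where Q: "\<And>s. s \<in> {0..t} \<Longrightarrow> Q s \<in> \<sigma>\<^sub>0 \<rightarrow>\<^sub>M ?B" "\<And>x. Q 0 x = x"
    "\<And>s. s \<in> {0..t} \<Longrightarrow> \<sigma> s = distr \<sigma>\<^sub>0 ?B (Q s)" "AE x in \<sigma>\<^sub>0. driven_by \<sigma> t (\<lambda>s. Q s x)"
    using weak_solution_as_flow[OF K \<sigma> \<sigma>0 t(2)] by blast
  have cost: "W1 (\<rho> t) (\<sigma> t) \<le> ?r * (\<integral>z. sphere_dist (fst z) (snd z) \<partial>\<pi>)"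
    if \<pi>: "\<pi> \<in> couplings \<rho>\<^sub>0 \<sigma>\<^sub>0" for \<pi>
  proof -
    note c = couplingD[OF \<pi> prob_measures_onD(1)[OF \<rho>0]]
    interpret prob_space \<pi> by (rule c)
    define p where "p s z = P s (fst z)" for s and z :: "'a \<times> 'a"
    define q where "q s z = Q s (snd z)" for s and z :: "'a \<times> 'a"
    have p: "p s \<in> \<pi> \<rightarrow>\<^sub>M ?B" and q: "q s \<in> \<pi> \<rightarrow>\<^sub>M ?B" if "s \<in> {0..t}" for s
      unfolding p_def[abs_def] q_def[abs_def]
      using measurable_compose[OF c(1) P(1)[OF that]] measurable_compose[OF c(2) Q(1)[OF that]] by auto
    have \<rho>p: "\<rho> s = distr \<pi> ?B (p s)" and \<sigma>q: "\<sigma> s = distr \<pi> ?B (q s)" if "s \<in> {0..t}" for s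
      using P(3)[OF that] Q(3)[OF that] distr_distr[OF P(1)[OF that] c(1)] distr_distr[OF Q(1)[OF that] c(2)] c(3,4)
      by (auto simp: p_def[abs_def] q_def[abs_def] comp_def)
    have driven_cong: "driven_by \<mu> t x = driven_by \<nu> t x" if "\<And>s. s \<in> {0..t} \<Longrightarrow> \<mu> s = \<nu> s" for \<mu> \<nu> x
      using that by (simp add: driven_by_def)
    have "AE z in \<pi>. driven_by \<rho> t (\<lambda>s. p s z)"
      unfolding p_def by (rule AE_distrD[OF c(1)]) (simp only: c(3) P(4))
    then have pd: "AE z in \<pi>. driven_by (\<lambda>s. distr \<pi> ?B (p s)) t (\<lambda>s. p s z)"
      using driven_cong[of \<rho> "\<lambda>s. distr \<pi> ?B (p s)"] \<rho>p by simp
    have "AE z in \<pi>. driven_by \<sigma> t (\<lambda>s. q s z)"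
      unfolding q_def by (rule AE_distrD[OF c(2)]) (simp only: c(4) Q(4))
    then have qd: "AE z in \<pi>. driven_by (\<lambda>s. distr \<pi> ?B (q s)) t (\<lambda>s. q s z)"
      using driven_cong[of \<sigma> "\<lambda>s. distr \<pi> ?B (q s)"] \<sigma>q by simp
    have start: "p 0 z = fst z" "q 0 z = snd z" for z by (simp_all add: p_def q_def P Q)
    define E0 where "E0 = (\<integral>z. norm (fst z - snd z) \<partial>\<pi>)"
    have growth: "AE z in \<pi>. \<forall>s\<in>{0..t}. norm ((p s z - q s z) - (fst z - snd z)) \<le>
        (norm (fst z - snd z) + 2 * E0) / 3 * (exp (4 * L * s) - 1)"
      using coupled_distance_growth[OF prob_space_axioms p q pd qd] by (simp add: start E0_def)
    have dist_int: "integrable \<pi> (\<lambda>z. sphere_dist (p s z) (q s z))" if s: "s \<in> {0..t}" for s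
    proof (rule integrable_bounded_prob_space[OF prob_space_axioms, of _ pi])
      show "(\<lambda>z. sphere_dist (p s z) (q s z)) \<in> borel_measurable \<pi>"
        by (rule measurable_sphere_dist[OF D p[OF s] q[OF s]])
      fix z assume z: "z \<in> space \<pi>"
      have "p s z \<in> sphere 0 1" "q s z \<in> sphere 0 1"
        using measurable_into_restrictD(2)[OF p[OF s] z] measurable_into_restrictD(2)[OF q[OF s] z] D by auto
      from inner_sphere_bounds[OF this] sphere_dist_nonneg[OF this]
      show "norm (sphere_dist (p s z) (q s z)) \<le> pi"
        by (simp add: sphere_dist_def arccos_ubound)
    qed
    have chord_int: "integrable \<pi> (\<lambda>z. norm (fst z - snd z))"
      using integrable_norm_diff[OF prob_space_axioms p[OF tt(2)] q[OF tt(2)]] by (simp add: start)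
    have dist_int0: "integrable \<pi> (\<lambda>z. sphere_dist (fst z) (snd z))"
      using dist_int[OF tt(2)] by (simp add: start)
    have inD: "fst z \<in> D" "snd z \<in> D" "p t z \<in> D" "q t z \<in> D" if "z \<in> space \<pi>" for z
      using measurable_into_restrictD(2)[OF p[OF tt(2)] that] measurable_into_restrictD(2)[OF q[OF tt(2)] that]
        measurable_into_restrictD(2)[OF p[OF tt(1)] that] measurable_into_restrictD(2)[OF q[OF tt(1)] that]
      by (simp_all add: start)
    \<comment> \<open>Mean chords are replaced by mean arcs only in the growth term, which vanishes at time \<open>0\<close>.\<close>
    have "E0 \<le> (\<integral>z. sphere_dist (fst z) (snd z) \<partial>\<pi>)"
      unfolding E0_def using inD(1,2)[THEN subsetD[OF D]]
      by (intro integral_mono chord_int dist_int0 chord_le_sphere_dist) simp_all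
    have "W1 (\<rho> t) (\<sigma> t) \<le> (\<integral>z. sphere_dist (fst z) (snd z) \<partial>distr \<pi> (\<rho> t \<Otimes>\<^sub>M \<sigma> t) (\<lambda>z. (p t z, q t z)))"
    proof (rule W1_le_coupling_cost)
      show "space (\<rho> t) \<subseteq> sphere 0 1" "space (\<sigma> t) \<subseteq> sphere 0 1"
        using D by (simp_all add: \<rho>p[OF tt(1)] \<sigma>q[OF tt(1)] space_restrict_space)
      show "distr \<pi> (\<rho> t \<Otimes>\<^sub>M \<sigma> t) (\<lambda>z. (p t z, q t z)) \<in> couplings (\<rho> t) (\<sigma> t)"
        by (rule coupling_push_forward[OF p[OF tt(1)] q[OF tt(1)] \<rho>p[OF tt(1)] \<sigma>q[OF tt(1)]])
    qed
    also have "\<dots> = (\<integral>z. sphere_dist (p t z) (q t z) \<partial>\<pi>)"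
    proof (subst integral_distr)
      show "(\<lambda>z. (p t z, q t z)) \<in> \<pi> \<rightarrow>\<^sub>M \<rho> t \<Otimes>\<^sub>M \<sigma> t"
        using p[OF tt(1)] q[OF tt(1)] \<rho>p[OF tt(1)] \<sigma>q[OF tt(1)] by (intro measurable_Pair) auto
      show "(\<lambda>z. sphere_dist (fst z) (snd z)) \<in> borel_measurable (\<rho> t \<Otimes>\<^sub>M \<sigma> t)"
        using \<rho>p[OF tt(1)] \<sigma>q[OF tt(1)] by (intro measurable_sphere_dist[OF D]) auto
    qed simp
    also have "\<dots> \<le> (\<integral>z. sphere_dist (fst z) (snd z)
        + M * ((norm (fst z - snd z) + 2 * E0) / 3 * (exp (4 * L * t) - 1)) \<partial>\<pi>)"
    proof (rule integral_mono_AE)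
      show "integrable \<pi> (\<lambda>z. sphere_dist (fst z) (snd z)
          + M * ((norm (fst z - snd z) + 2 * E0) / 3 * (exp (4 * L * t) - 1)))"
        using dist_int0 chord_int by auto
      show "AE z in \<pi>. sphere_dist (p t z) (q t z) \<le> sphere_dist (fst z) (snd z)
          + M * ((norm (fst z - snd z) + 2 * E0) / 3 * (exp (4 * L * t) - 1))"
        using growth AE_space
      proof eventually_elim
        case (elim z)
        note in_D = inD[OF elim(2)]
        have "\<bar>norm (p t z - q t z) - norm (fst z - snd z)\<bar>
            \<le> (norm (fst z - snd z) + 2 * E0) / 3 * (exp (4 * L * t) - 1)"
          using elim(1) tt norm_triangle_ineq3[of "p t z - q t z" "fst z - snd z"] by (meson order_trans)
        from mult_left_mono[OF this, of M] M(2)[OF in_D(3,4,1,2)] M(1)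
        show ?case by linarith
      qed
    qed (rule dist_int[OF tt(1)])
    also have "\<dots> = (\<integral>z. sphere_dist (fst z) (snd z) \<partial>\<pi>) + M * (E0 * (exp (4 * L * t) - 1))"
    proof -
      have "(\<integral>z. sphere_dist (fst z) (snd z)
          + M * ((norm (fst z - snd z) + 2 * E0) / 3 * (exp (4 * L * t) - 1)) \<partial>\<pi>)
        = (\<integral>z. sphere_dist (fst z) (snd z) \<partial>\<pi>)
          + M * ((E0 + 2 * E0) / 3 * (exp (4 * L * t) - 1))"
        using dist_int0 chord_int by (simp add: E0_def prob_space)
      then show ?thesis by simp
    qed
    also have "\<dots> \<le> ?r * (\<integral>z. sphere_dist (fst z) (snd z) \<partial>\<pi>)"
    proof -
      have "M * (E0 * (exp (4 * L * t) - 1))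
          \<le> M * ((\<integral>z. sphere_dist (fst z) (snd z) \<partial>\<pi>) * (exp (4 * L * t) - 1))"
        using \<open>E0 \<le> _\<close> e M(1) by (intro mult_left_mono mult_right_mono) auto
      then show ?thesis by (simp add: algebra_simps)
    qed
    finally show ?thesis .
  qed
  have r: "0 < ?r" using e M(1) by (intro add_pos_nonneg) auto
  \<comment> \<open>The factor \<open>?r\<close> does not depend on the coupling, so the infimum can be taken.\<close>
  have "W1 (\<rho> t) (\<sigma> t) / ?r \<le> W1 \<rho>\<^sub>0 \<sigma>\<^sub>0"
    unfolding W1_def[of \<rho>\<^sub>0]
  proof (rule cINF_greatest)
    show "couplings \<rho>\<^sub>0 \<sigma>\<^sub>0 \<noteq> {}"
      using couplings_nonempty prob_measures_onD(1) \<rho>0 \<sigma>0 by blast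
    fix \<pi> assume "\<pi> \<in> couplings \<rho>\<^sub>0 \<sigma>\<^sub>0"
    from cost[OF this] r show "W1 (\<rho> t) (\<sigma> t) / ?r \<le> (\<integral>z. sphere_dist (fst z) (snd z) \<partial>\<pi>)"
      by (simp add: pos_divide_le_eq mult.commute)
  qed
  with r show ?thesis by (simp add: pos_divide_le_eq mult.commute)
qed

theorem theorem3p8:
  fixes K :: "(real ^ 'k) \<times> real \<Rightarrow> (real ^ 'k) \<times> real \<Rightarrow> real"
    and g g' :: "real \<Rightarrow> real"
    and \<epsilon> :: real
    and T :: ereal
  assumes "0 < \<epsilon>" and "\<epsilon> < pi / 2"
    and "0 < T"
    and "\<And>x y. x \<in> sphere 0 1 \<Longrightarrow> y \<in> sphere 0 1 \<Longrightarrow> K x y = g ((sphere_dist x y)\<^sup>2)"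
    and "\<And>s. 0 \<le> s \<Longrightarrow> (g has_real_derivative g' s) (at s within {0..})"
    and "locally_lipschitz_on {0..} g'"
  shows "\<exists>r :: real \<Rightarrow> real. \<forall>\<rho>\<^sub>0 \<sigma>\<^sub>0 \<rho> \<sigma>.
    \<rho>\<^sub>0 \<in> prob_measures_on (polar_cap \<epsilon>) \<longrightarrow>
    \<sigma>\<^sub>0 \<in> prob_measures_on (polar_cap \<epsilon>) \<longrightarrow>
    weak_solution K (polar_cap \<epsilon>) T \<rho>\<^sub>0 \<rho> \<longrightarrow>
    weak_solution K (polar_cap \<epsilon>) T \<sigma>\<^sub>0 \<sigma> \<longrightarrow>
    (\<exists>T'::real. 0 < T' \<and> ereal T' < T \<and>
      strict_mono_on {0..<T'} r \<and> bounded (r ` {0..<T'}) \<and> r 0 = 1 \<and>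
      (\<forall>t\<in>{0..<T'}. W1 (\<rho> t) (\<sigma> t) \<le> r t * W1 \<rho>\<^sub>0 \<sigma>\<^sub>0))"
proof -
  let ?D = "polar_cap \<epsilon> :: ((real ^ 'k) \<times> real) set"
  define c0 where "c0 = 2 * (sin \<epsilon>)\<^sup>2 - 1"
  have "0 < sin \<epsilon>" using assms(1,2) by (intro sin_gt_zero) auto
  then have c0: "-1 < c0" by (simp add: c0_def)
  have D: "?D \<subseteq> sphere 0 1" by (auto simp: polar_cap_def)
  have inner: "c0 \<le> x \<bullet> y" if "x \<in> ?D" "y \<in> ?D" for x y
    unfolding c0_def using polar_cap_inner_ge[OF assms(1,2) that] .
  obtain L where L: "0 < L" "\<And>x y x' y'. \<lbrakk>x \<in> ?D; y \<in> ?D; x' \<in> ?D; y' \<in> ?D\<rbrakk> \<Longrightarrow>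
      norm (radial_grad g' x y - radial_grad g' x' y') \<le> L * (norm (x - x') + norm (y - y'))"
    using radial_grad_lipschitz[OF c0 D inner assms(6)] by blast
  obtain M where M: "0 < M" "\<And>x y x' y'. \<lbrakk>x \<in> ?D; y \<in> ?D; x' \<in> ?D; y' \<in> ?D\<rbrakk> \<Longrightarrow>
      \<bar>sphere_dist x y - sphere_dist x' y'\<bar> \<le> M * \<bar>norm (x - y) - norm (x' - y')\<bar>"
    using sphere_dist_chord_lipschitz[OF c0 D inner] by blast
  interpret lipschitz_interaction ?D "radial_grad g'" L
    by unfold_locales (use L bounded_subset[OF bounded_sphere D] in auto)
  have grad: "sphere_grad (\<lambda>z. K z y) x = radial_grad g' x y" if "x \<in> ?D" "y \<in> ?D" for x y
    using D that inner[OF that] c0 by (intro sphere_grad_radial[OF assms(4,5)]) auto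
  define r where "r t = 1 + M * (exp (4 * L * t) - 1)" for t
  obtain T' where T': "0 < T'" "ereal T' < T"
    using ereal_dense2[OF \<open>0 < T\<close>] by auto
  have "strict_mono_on {0..<T'} r"
    using L(1) M(1) by (auto simp: r_def intro!: strict_mono_onI)
  moreover have "bounded (r ` {0..<T'})"
  proof (rule bounded_subset)
    have "continuous_on {0..T'} r" unfolding r_def by (intro continuous_intros)
    then show "bounded (r ` {0..T'})"
      by (intro compact_imp_bounded compact_continuous_image compact_Icc)
  qed auto
  moreover have "r 0 = 1" by (simp add: r_def)
  moreover have "W1 (\<rho> t) (\<sigma> t) \<le> r t * W1 \<rho>\<^sub>0 \<sigma>\<^sub>0"
    if "\<rho>\<^sub>0 \<in> prob_measures_on ?D" "\<sigma>\<^sub>0 \<in> prob_measures_on ?D"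
      "weak_solution K ?D T \<rho>\<^sub>0 \<rho>" "weak_solution K ?D T \<sigma>\<^sub>0 \<sigma>" "t \<in> {0..<T'}" for \<rho>\<^sub>0 \<sigma>\<^sub>0 \<rho> \<sigma> t
    unfolding r_def
  proof (rule W1_stability[OF D M grad that(1-4)])
    show "0 \<le> t" using that by simp
    have "ereal t < ereal T'" using that by simp
    then show "ereal t < T" using T'(2) by (rule less_trans)
  qed
  ultimately show ?thesis using T' by blast
qed

end
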